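(* Let $G$ be a planar triangulation. Then either $G$ is quasi-isometric to a tree, or for every $r \in \mathbb{N}$ there is a vertex $v$ of $G$ such that $|B_v(r)| > r^2$.
   Context: A plane graph is a subset of $\mathbb{R}^2$ that is homeomorphic to a graph when the latter is viewed as a 1-complex (i.e. a planar graph with a fixed embedding in $\mathbb{R}^2$). A face of a plane graph $G$ is a component of $\mathbb{R}^2 \setminus G$. A facial triangle of $G$ is a cycle consisting of three edges that bounds a face. A planar triangulation is a connected plane graph every edge of which is contained in two facial triangles (it may be finite or infinite, with any number of ends). The graph distance $d(x,y)$ between vertices $x,y$ is the minimum number of edges in an $x$–$y$ path. $B_v(r)$ is the set of vertices at graph distance at most $r$ from $v$, and $|B_v(r)|$ is its number of vertices. A quasi-isometry between graphs $G=(V,E)$ and $H=(V',E')$ is a map $f:V\to V'$ such that for some constants $M\ge 1$, $A\ge 0$: (1) $M^{-1}d(x,y)-A\le d(f(x),f(y))\le M d(x,y)+A$ for all $x,y\in V$; and (2) for every $z\in V'$ there is $x\in V$ with $d(z,f(x))\le A$. Two graphs are quasi-isometric if such a map exists. A tree is a connected acyclic graph (finite or infinite). *)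

theory Defs
  imports "HOL-Analysis.Analysis"
begin

section \<open>Simple graphs\<close>

text \<open>A graph is a vertex set \<open>V\<close>, finite or infinite, with a set \<open>E\<close> of two-element subsets of \<open>V\<close>.\<close>

definition graph :: "'v set \<Rightarrow> 'v set set \<Rightarrow> bool" where
  "graph V E \<longleftrightarrow> (\<forall>e\<in>E. e \<subseteq> V \<and> card e = 2)"

definition path_between :: "'v set \<Rightarrow> 'v set set \<Rightarrow> 'v \<Rightarrow> 'v \<Rightarrow> 'v list \<Rightarrow> bool" where
  "path_between V E x y p \<longleftrightarrow>
     p \<noteq> [] \<and> hd p = x \<and> last p = y \<and> set p \<subseteq> V \<and> distinct p \<and>
     successively (\<lambda>u v. {u, v} \<in> E) p"

definition connected_graph :: "'v set \<Rightarrow> 'v set set \<Rightarrow> bool" where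
  "connected_graph V E \<longleftrightarrow>
     graph V E \<and> V \<noteq> {} \<and> (\<forall>x\<in>V. \<forall>y\<in>V. \<exists>p. path_between V E x y p)"

text \<open>The distance is meaningful only if the two vertices are joined by a path; it is used for
  connected graphs only.\<close>

definition graph_dist :: "'v set \<Rightarrow> 'v set set \<Rightarrow> 'v \<Rightarrow> 'v \<Rightarrow> nat" where
  "graph_dist V E x y = (LEAST n. \<exists>p. path_between V E x y p \<and> n = length p - 1)"

definition graph_ball :: "'v set \<Rightarrow> 'v set set \<Rightarrow> 'v \<Rightarrow> nat \<Rightarrow> 'v set" where
  "graph_ball V E v r = {u \<in> V. graph_dist V E v u \<le> r}"

text \<open>A cycle is listed by its vertices in cyclic order, the first one not being repeated at the end.\<close>

definition cycle_edges :: "'v list \<Rightarrow> 'v set set" where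
  "cycle_edges p = {{p ! i, p ! (Suc i mod length p)} | i. i < length p}"

definition is_cycle :: "'v set \<Rightarrow> 'v set set \<Rightarrow> 'v list \<Rightarrow> bool" where
  "is_cycle V E p \<longleftrightarrow> 3 \<le> length p \<and> distinct p \<and> set p \<subseteq> V \<and> cycle_edges p \<subseteq> E"

definition tree :: "'v set \<Rightarrow> 'v set set \<Rightarrow> bool" where
  "tree V E \<longleftrightarrow> connected_graph V E \<and> (\<nexists>p. is_cycle V E p)"

definition quasi_isometry ::
  "'v set \<Rightarrow> 'v set set \<Rightarrow> 'w set \<Rightarrow> 'w set set \<Rightarrow> ('v \<Rightarrow> 'w) \<Rightarrow> bool" where
  "quasi_isometry V E V' E' f \<longleftrightarrow>
     f \<in> V \<rightarrow> V' \<and>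
     (\<exists>M A :: real. M \<ge> 1 \<and> A \<ge> 0 \<and>
        (\<forall>x\<in>V. \<forall>y\<in>V.
           inverse M * real (graph_dist V E x y) - A \<le> real (graph_dist V' E' (f x) (f y)) \<and>
           real (graph_dist V' E' (f x) (f y)) \<le> M * real (graph_dist V E x y) + A) \<and>
        (\<forall>z\<in>V'. \<exists>x\<in>V. real (graph_dist V' E' z (f x)) \<le> A))"

definition quasi_isometric ::
  "'v set \<Rightarrow> 'v set set \<Rightarrow> 'w set \<Rightarrow> 'w set set \<Rightarrow> bool" where
  "quasi_isometric V E V' E' \<longleftrightarrow> (\<exists>f. quasi_isometry V E V' E' f)"

section \<open>Graphs as 1-complexes\<close>

text \<open>Points of the 1-complex are given by barycentric coordinates: the vertex \<open>v\<close> is the unique point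
  of \<open>cell {v}\<close>, and an edge \<open>e = {u, v}\<close> is the segment \<open>cell e\<close> between its end vertices.\<close>

definition cell :: "'v set \<Rightarrow> ('v \<Rightarrow> real) set" where
  "cell s = {x. (\<forall>w. 0 \<le> x w) \<and> (\<forall>w. w \<notin> s \<longrightarrow> x w = 0) \<and> sum x s = 1}"

definition complex_points :: "'v set \<Rightarrow> 'v set set \<Rightarrow> ('v \<Rightarrow> real) set" where
  "complex_points V E = (\<Union>v\<in>V. cell {v}) \<union> (\<Union>e\<in>E. cell e)"

text \<open>The 1-complex carries the weak (CW) topology: a set is open iff it meets every closed edge in a
  relatively open set. On a closed edge the product topology of the function space is the usual
  topology of a segment. At vertices of infinite degree the weak topology is strictly finer than
  the product topology.\<close>

definition one_complex :: "'v set \<Rightarrow> 'v set set \<Rightarrow> ('v \<Rightarrow> real) topology" where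
  "one_complex V E =
     topology (\<lambda>U. U \<subseteq> complex_points V E \<and> (\<forall>e\<in>E. openin (top_of_set (cell e)) (U \<inter> cell e)))"

lemma openin_one_complex:
  "openin (one_complex V E) U \<longleftrightarrow>
     U \<subseteq> complex_points V E \<and> (\<forall>e\<in>E. openin (top_of_set (cell e)) (U \<inter> cell e))"
proof -
  have "istopology (\<lambda>U. U \<subseteq> complex_points V E \<and>
          (\<forall>e\<in>E. openin (top_of_set (cell e)) (U \<inter> cell e)))"
    unfolding istopology_def
  proof (intro conjI allI impI ballI)
    fix S T e
    assume S: "S \<subseteq> complex_points V E \<and> (\<forall>e\<in>E. openin (top_of_set (cell e)) (S \<inter> cell e))"
      and T: "T \<subseteq> complex_points V E \<and> (\<forall>e\<in>E. openin (top_of_set (cell e)) (T \<inter> cell e))"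
    show "S \<inter> T \<subseteq> complex_points V E" using S by blast
    assume "e \<in> E"
    then have "openin (top_of_set (cell e)) ((S \<inter> cell e) \<inter> (T \<inter> cell e))"
      using S T openin_Int[of "top_of_set (cell e)" "S \<inter> cell e" "T \<inter> cell e"] by blast
    moreover have "(S \<inter> cell e) \<inter> (T \<inter> cell e) = S \<inter> T \<inter> cell e" by blast
    ultimately show "openin (top_of_set (cell e)) (S \<inter> T \<inter> cell e)" by simp
  next
    fix K e
    assume K: "\<forall>S\<in>K. S \<subseteq> complex_points V E \<and>
                 (\<forall>e\<in>E. openin (top_of_set (cell e)) (S \<inter> cell e))"
    show "\<Union> K \<subseteq> complex_points V E" using K by blast
    assume "e \<in> E"
    then have "openin (top_of_set (cell e)) (\<Union>S\<in>K. S \<inter> cell e)"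
      using K by (intro openin_Union) blast
    moreover have "(\<Union>S\<in>K. S \<inter> cell e) = \<Union> K \<inter> cell e" by blast
    ultimately show "openin (top_of_set (cell e)) (\<Union> K \<inter> cell e)" by simp
  qed
  then show ?thesis
    by (simp add: one_complex_def topology_inverse')
qed

lemma topspace_one_complex: "topspace (one_complex V E) = complex_points V E"
proof
  show "topspace (one_complex V E) \<subseteq> complex_points V E"
    by (metis openin_one_complex openin_topspace)
  have "complex_points V E \<inter> cell e = cell e" if "e \<in> E" for e
    using that by (auto simp: complex_points_def)
  then have "openin (one_complex V E) (complex_points V E)"
    by (auto simp: openin_one_complex)
  then show "complex_points V E \<subseteq> topspace (one_complex V E)"
    by (rule openin_subset)
qed

section \<open>Plane graphs\<close>

text \<open>A plane graph is given by an abstract graph together with a homeomorphism \<open>\<phi>\<close> from its 1-complex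
  onto a subset of the plane. That subset need not be closed in the plane. The vertex set is part
  of the data since it cannot be recovered from the point set.\<close>

definition plane_graph :: "'v set \<Rightarrow> 'v set set \<Rightarrow> (('v \<Rightarrow> real) \<Rightarrow> real ^ 2) \<Rightarrow> bool" where
  "plane_graph V E \<phi> \<longleftrightarrow> graph V E \<and> embedding_map (one_complex V E) euclidean \<phi>"

definition faces :: "'v set \<Rightarrow> 'v set set \<Rightarrow> (('v \<Rightarrow> real) \<Rightarrow> real ^ 2) \<Rightarrow> (real ^ 2) set set" where
  "faces V E \<phi> = components (- (\<phi> ` topspace (one_complex V E)))"

text \<open>Cycles are identified with their edge sets here. The face may be the unbounded one.\<close>

definition facial_triangle ::
  "'v set \<Rightarrow> 'v set set \<Rightarrow> (('v \<Rightarrow> real) \<Rightarrow> real ^ 2) \<Rightarrow> 'v set set \<Rightarrow> bool" where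
  "facial_triangle V E \<phi> T \<longleftrightarrow>
     (\<exists>p. is_cycle V E p \<and> T = cycle_edges p) \<and> card T = 3 \<and>
     (\<exists>F \<in> faces V E \<phi>. frontier F = \<phi> ` (\<Union>e\<in>T. cell e))"

definition planar_triangulation ::
  "'v set \<Rightarrow> 'v set set \<Rightarrow> (('v \<Rightarrow> real) \<Rightarrow> real ^ 2) \<Rightarrow> bool" where
  "planar_triangulation V E \<phi> \<longleftrightarrow>
     plane_graph V E \<phi> \<and> connected_graph V E \<and>
     (\<forall>e\<in>E. \<exists>T1 T2. T1 \<noteq> T2 \<and> facial_triangle V E \<phi> T1 \<and> facial_triangle V E \<phi> T2 \<and>
                    e \<in> T1 \<and> e \<in> T2)"

end

(*
Fix a root and let x ~ y if x and y are on the same level n (distance from the root) and are joined by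
a path that stays on the levels >= n. The classes form a tree. If they have bounded diameter, then
the quotient map is a quasi-isometry.

Otherwise take x ~ y with d(x,y) > 6r. Facial triangles generate the cycle space mod 2: the
parity of a cycle against a set of edges is the sum of the parities of the facial triangles inside
the Jordan curve of that cycle. The downward edges of the component of x in its level meet every triangle
in an even number of edges. If this component did not contain y, then a path from x to y on the levels
>= n, closed up below level n, would be a cycle with exactly one of them. So equivalent vertices
are joined within their level. This holds for the ancestors
x_i, y_i of x and y on level n - i as well, and for i <= 2r the distance of x_i and y_i is more than 2r.
So level n - i contains at least r - |r - i| + 1 vertices within distance r - |r - i| of x_i; all of
them are within distance r of x_r, and there are (r + 1)^2 in total.
*)

theory Submission
  imports Defs
begin

section \<open>Jordan curves and theta graphs\<close>

text \<open>The union of the arcs need not be closed and infinitely many triangles may lie inside a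
  Jordan curve, so a face need not be open and a sum over all triangles inside need not be finite.
  Openness is recovered for faces whose frontier is a triangle. Two such faces at a common edge,
  together with the open edge, form an open set. Hence no third facial triangle contains that edge,
  and the two faces lie on different sides of a cycle exactly if the edge belongs to it. The parity
  count then involves only triangles with an edge in a finite set. Finiteness of that set, of the
  levels and of the balls rests on local finiteness, which comes from the weak topology: a vertex of
  infinite degree would rule out an embedding in the plane. For balls it also matters that
  \<open>card\<close> of an infinite set is 0. The factor 6: descending 2r levels costs at most 2r
  at each end, so a distance above 6r leaves more than 2r between the ancestors.\<close>

definition jordan_curve :: "complex set \<Rightarrow> bool" where
  "jordan_curve J \<longleftrightarrow> (\<exists>c. simple_path c \<and> pathfinish c = pathstart c \<and> path_image c = J)"

lemma jordan_curve_sides: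
  assumes "jordan_curve J"
  shows "open (inside J)" "open (outside J)" "connected (inside J)" "connected (outside J)"
    "inside J \<noteq> {}" "outside J \<noteq> {}" "inside J \<inter> outside J = {}" "inside J \<union> outside J = - J"
    "frontier (inside J) = J" "frontier (outside J) = J" "bounded (inside J)" "bounded J" "closed J"
proof -
  obtain c where c: "simple_path c" "pathfinish c = pathstart c" "path_image c = J"
    using assms by (auto simp: jordan_curve_def)
  show "open (inside J)" "open (outside J)" "connected (inside J)" "connected (outside J)"
    "inside J \<noteq> {}" "outside J \<noteq> {}" "inside J \<inter> outside J = {}" "inside J \<union> outside J = - J"
    "frontier (inside J) = J" "frontier (outside J) = J" "bounded (inside J)"
    using Jordan_inside_outside[OF c(1,2)] c(3) by blast+
  show "bounded J" "closed J"
    using c compact_simple_path_image[of c] compact_imp_bounded compact_imp_closed by blast+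
qed

lemma components_Compl_jordan_curve:
  assumes "jordan_curve J"
  shows "components (- J) = {inside J, outside J}"
proof -
  note j = jordan_curve_sides[OF assms]
  have "inside J \<in> components (- J)" "outside J \<in> components (- J)"
    using j componentsI
    by (metis Compl_iff inside_in_components outside_in_components)+
  moreover have "C = inside J \<or> C = outside J" if "C \<in> components (- J)" for C
  proof -
    have "C \<noteq> {}" "C \<subseteq> - J"
      by (fact in_components_nonempty[OF that], fact in_components_subset[OF that])
    then obtain x where "x \<in> C" "x \<in> - J" by blast
    then show ?thesis
      using j(8) calculation components_eq[OF that] by blast
  qed
  ultimately show ?thesis by blast
qed

text \<open>The set \<open>X\<close> need not be closed, so a component of its complement need not be open; one whose
  frontier lies in \<open>X\<close> is.\<close>

lemma component_with_jordan_frontier: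
  assumes F: "F \<in> components (- X)" and J: "jordan_curve J" and fr: "frontier F = J" and JX: "J \<subseteq> X"
  shows "F \<in> components (- J)" "open F" "closure F = F \<union> J" "F \<inter> J = {}"
proof -
  have FX: "F \<subseteq> - X" and Fc: "connected F" and Fn: "F \<noteq> {}"
    using F in_components_subset in_components_connected in_components_nonempty by blast+
  show FJ: "F \<inter> J = {}" using FX JX by blast
  then show o: "open F"
    using fr by (metis frontier_disjoint_eq inf_commute)
  show cl: "closure F = F \<union> J" using fr closure_Un_frontier by metis
  \<comment> \<open>A connected set properly containing \<open>F\<close> meets
    \<open>frontier F\<close>, that is \<open>J\<close>; so \<open>F\<close> is maximal already in
    \<open>- J\<close>.\<close>
  have "C = F" if "connected C" "F \<subseteq> C" "C \<subseteq> - J" for C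
  proof (rule ccontr)
    assume "C \<noteq> F"
    then have "C \<inter> frontier F \<noteq> {}"
      using connected_Int_frontier[OF that(1)] Fn that(2) by blast
    then show False using fr that(3) by blast
  qed
  then show "F \<in> components (- J)"
    using FJ Fc Fn unfolding in_components_maximal by blast
qed

text \<open>Janiszewski's theorem shows that the complement of \<open>closure F \<union> closure G\<close> is connected. So it
  is one side of the Jordan curve \<open>a \<union> b\<close>, and the set in question is the other side.\<close>

lemma theta_component:
  fixes e a b :: "real \<Rightarrow> complex"
  assumes arcs: "arc e" "arc a" "arc b" "pathstart e = u" "pathfinish e = v"
    "pathstart a = u" "pathfinish a = v" "pathstart b = u" "pathfinish b = v"
    and ea: "path_image e \<inter> path_image a = {u, v}" and eb: "path_image e \<inter> path_image b = {u, v}"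
    and ab: "path_image a \<inter> path_image b = {u, v}"
    and F: "F \<in> components (- X)" "frontier F = path_image e \<union> path_image a"
    and G: "G \<in> components (- X)" "frontier G = path_image e \<union> path_image b"
    and X: "path_image e \<subseteq> X" "path_image a \<subseteq> X" "path_image b \<subseteq> X"
  shows "open (F \<union> (path_image e - {u, v}) \<union> G)"
proof -
  define J1 where "J1 = path_image e \<union> path_image a"
  define J2 where "J2 = path_image e \<union> path_image b"
  define J3 where "J3 = path_image a \<union> path_image b"
  define N where "N = F \<union> (path_image e - {u, v}) \<union> G"
  have uv: "u \<in> path_image e" "v \<in> path_image e" "u \<noteq> v"
    using arcs arc_distinct_ends[OF arcs(1)] by auto
  have jc: "jordan_curve (path_image g \<union> path_image h)"
    if "arc g" "arc h" "pathstart g = u" "pathfinish g = v" "pathstart h = u" "pathfinish h = v"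
      "path_image g \<inter> path_image h = {u, v}" for g h
    unfolding jordan_curve_def using that
    by (intro exI[of _ "g +++ reversepath h"]) (auto simp: path_image_join arc_reversepath intro!: simple_path_join_loop)
  have j: "jordan_curve J1" "jordan_curve J2" "jordan_curve J3"
    unfolding J1_def J2_def J3_def using jc arcs ea eb ab by auto
  have JX: "J1 \<subseteq> X" "J2 \<subseteq> X" "J3 \<subseteq> X" using X by (auto simp: J1_def J2_def J3_def)
  note f = component_with_jordan_frontier[OF F(1) j(1) F(2)[folded J1_def] JX(1)]
  note g = component_with_jordan_frontier[OF G(1) j(2) G(2)[folded J2_def] JX(2)]
  have FX: "F \<inter> X = {}" "G \<inter> X = {}" using F G in_components_subset by fastforce+
  \<comment> \<open>Equal faces have equal frontiers, which would force the arc \<open>a\<close>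
    into \<open>e\<close> and \<open>b\<close>, that is into its two end points.\<close>
  have "F \<noteq> G"
  proof
    assume "F = G"
    then have "path_image a \<subseteq> {u,v}" using F(2) G(2) ea ab by blast
    moreover have "infinite (path_image a)" 
      using arcs(2,6,7) uv(3) connected_arc_image[OF arcs(2)] connected_finite_iff_sing[of "path_image a"]
      by (metis empty_iff insert_iff pathfinish_in_path_image pathstart_in_path_image)
    ultimately show False using finite_subset by blast
  qed
  then have FG: "F \<inter> G = {}" using F(1) G(1) components_nonoverlap by metis
  have fj: "F = inside J1 \<or> F = outside J1" and gj: "G = inside J2 \<or> G = outside J2"
    using f(1) g(1) components_Compl_jordan_curve j by auto
  have other: "connected (- (C \<union> J))" if "jordan_curve J" "C = inside J \<or> C = outside J" for C J
  proof -
    have "- (C \<union> J) = inside J \<or> - (C \<union> J) = outside J"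
      using jordan_curve_sides(7,8)[OF that(1)] that(2) by blast
    then show ?thesis using jordan_curve_sides(3,4)[OF that(1)] by auto
  qed
  \<comment> \<open>Janiszewski's theorem asks for one compact set. If both faces were unbounded,
    their complements would be bounded and, the faces being disjoint, would cover the plane.\<close>
  have bd: "bounded F \<or> bounded G"
  proof (rule ccontr)
    assume "\<not> ?thesis"
    then have "F = outside J1" "G = outside J2"
      using fj gj jordan_curve_sides(11) j by auto
    then have "- F = inside J1 \<union> J1" "- G = inside J2 \<union> J2"
      using jordan_curve_sides(7,8)[OF j(1)] jordan_curve_sides(7,8)[OF j(2)] by blast+
    then have "bounded (- F \<union> - G)"
      using jordan_curve_sides(11,12)[OF j(1)] jordan_curve_sides(11,12)[OF j(2)] by simp
    moreover have "- F \<union> - G = UNIV" using FG by blast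
    ultimately show False using not_bounded_UNIV by metis
  qed
  have cl: "closed (F \<union> J1)" "closed (G \<union> J2)" by (metis f(3) closed_closure, metis g(3) closed_closure)
  have int: "(F \<union> J1) \<inter> (G \<union> J2) = path_image e"
    using FG FX JX ab uv by (auto simp: J1_def J2_def)
  have cone: "connected ((F \<union> J1) \<inter> (G \<union> J2))"
    unfolding int using arcs(1) by (simp add: connected_arc_image)
  have W: "connected (- ((F \<union> J1) \<union> (G \<union> J2)))"
    unfolding connected_iff_connected_component
  proof (intro ballI)
    fix x y assume xy: "x \<in> - ((F \<union> J1) \<union> (G \<union> J2))" "y \<in> - ((F \<union> J1) \<union> (G \<union> J2))"
    have c1: "connected_component (- (F \<union> J1)) x y" "connected_component (- (G \<union> J2)) x y"
      using other[OF j(1) fj] other[OF j(2) gj] xy unfolding connected_iff_connected_component by auto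
    show "connected_component (- ((F \<union> J1) \<union> (G \<union> J2))) x y"
    proof (cases "bounded F")
      case True
      then have "compact (F \<union> J1)" using cl jordan_curve_sides(12)[OF j(1)] by (simp add: compact_eq_bounded_closed)
      then show ?thesis using Janiszewski cl cone c1 by blast
    next
      case False
      then have "compact (G \<union> J2)" using bd cl jordan_curve_sides(12)[OF j(2)] by (simp add: compact_eq_bounded_closed)
      moreover have "connected ((G \<union> J2) \<inter> (F \<union> J1))" using cone by (simp add: Int_commute)
      ultimately have "connected_component (- ((G \<union> J2) \<union> (F \<union> J1))) x y" 
        using Janiszewski cl c1 by blast
      then show ?thesis by (simp add: Un_commute)
    qed
  qed
  have N: "connected N"
  proof -
    have endless: "connected (path_image e - {u, v})" "path_image e - {u, v} \<noteq> {}"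
      using connected_simple_path_endless nonempty_simple_path_endless arc_imp_simple_path arcs(1,4,5) by metis+
    obtain p where p: "p \<in> path_image e - {u, v}" using endless by blast
    \<comment> \<open>The open edge lies in the closure of each face, so one of its points can be
      added to the face, and then all of it.\<close>
    have *: "connected (H \<union> (path_image e - {u, v}))" if "connected H" "path_image e \<subseteq> closure H" for H
    proof -
      have "connected (insert p H)"
        by (rule connected_intermediate_closure[OF that(1)]) (use p that(2) closure_subset in blast)+
      then have "connected (insert p H \<union> (path_image e - {u, v}))"
        using endless p by (intro connected_Un) auto
      moreover have "insert p H \<union> (path_image e - {u, v}) = H \<union> (path_image e - {u, v})" using p by blast
      ultimately show ?thesis by simp
    qed
    have "connected (F \<union> (path_image e - {u, v}))" "connected (G \<union> (path_image e - {u, v}))"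
      using F G f(3) g(3) in_components_connected by (auto simp: J1_def J2_def intro!: *)
    moreover have "(F \<union> (path_image e - {u, v})) \<inter> (G \<union> (path_image e - {u, v})) \<noteq> {}"
      using endless by blast
    ultimately have "connected ((F \<union> (path_image e - {u, v})) \<union> (G \<union> (path_image e - {u, v})))"
      by (rule connected_Un)
    then show ?thesis by (simp add: N_def Un_ac)
  qed
  \<comment> \<open>Off \<open>a\<close> and \<open>b\<close> the plane consists of \<open>N\<close>
    and the complement of the two closed faces. These sets are disjoint and connected, so each is
    one side of \<open>J3\<close>.\<close>
  have split: "- J3 = N \<union> - ((F \<union> J1) \<union> (G \<union> J2))"
  proof -
    have "(path_image e - {u, v}) \<inter> J3 = {}" "u \<in> J3" "v \<in> J3"
      using ea eb ab by (auto simp: J3_def)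
    moreover have "J1 \<union> J2 = path_image e \<union> J3" by (auto simp: J1_def J2_def J3_def)
    ultimately show ?thesis using FX JX(3) unfolding N_def by blast
  qed
  have "N \<noteq> {}" using F by (auto simp: N_def dest: in_components_nonempty)
  have dj: "N \<inter> - ((F \<union> J1) \<union> (G \<union> J2)) = {}" by (auto simp: N_def J1_def)
  have "N = inside J3 \<or> N = outside J3"
  proof -
    note s = jordan_curve_sides[OF j(3)]
    have *: "C \<subseteq> inside J3 \<or> C \<subseteq> outside J3" if "connected C" "C \<subseteq> - J3" for C
      using connectedD[OF that(1) s(1) s(2)] s(7,8) that(2) by blast
    have "N \<subseteq> inside J3 \<or> N \<subseteq> outside J3" using * N split by blast
    moreover have "- ((F \<union> J1) \<union> (G \<union> J2)) \<subseteq> inside J3 \<or> - ((F \<union> J1) \<union> (G \<union> J2)) \<subseteq> outside J3"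
      using * W split by blast
    moreover have "A = I \<or> A = O'" if "A \<subseteq> I \<or> A \<subseteq> O'" "B \<subseteq> I \<or> B \<subseteq> O'" "A \<union> B = I \<union> O'"
      "A \<inter> B = {}" "I \<inter> O' = {}" "I \<noteq> {}" "O' \<noteq> {}" for A B I O' :: "complex set"
      using that(1)
    proof
      assume "A \<subseteq> I"
      then have "B \<subseteq> O'" using that(2,3,5,7) by blast
      then have "A = I" using \<open>A \<subseteq> I\<close> that(3,5) by blast
      then show ?thesis ..
    next
      assume "A \<subseteq> O'"
      then have "B \<subseteq> I" using that(2,3,5,6) by blast
      then have "A = O'" using \<open>A \<subseteq> O'\<close> that(3,5) by blast
      then show ?thesis ..
    qed
    ultimately show ?thesis using s(5-8) split dj by metis
  qed
  then show ?thesis using jordan_curve_sides(1,2)[OF j(3)] N_def by metis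
qed

section \<open>Graphs with arcs as edges\<close>

fun path_edges :: "'v list \<Rightarrow> 'v set set" where
  "path_edges (x # y # zs) = insert {x, y} (path_edges (y # zs))"
| "path_edges _ = {}"

lemma path_edges_conv_nth: "path_edges p = {{p ! i, p ! Suc i} | i. Suc i < length p}"
proof (induction p rule: path_edges.induct)
  case (1 x y zs)
  have "{{(x # y # zs) ! i, (x # y # zs) ! Suc i} | i. Suc i < length (x # y # zs)} =
        insert {x, y} {{(y # zs) ! i, (y # zs) ! Suc i} | i. Suc i < length (y # zs)}" (is "?L = ?R")
  proof (rule set_eqI)
    fix e
    show "e \<in> ?L \<longleftrightarrow> e \<in> ?R"
    proof
      assume "e \<in> ?L"
      then obtain i where "e = {(x # y # zs) ! i, (x # y # zs) ! Suc i}" "Suc i < length (x # y # zs)"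
        by blast
      then show "e \<in> ?R" by (cases i) auto
    next
      assume "e \<in> ?R"
      then consider "e = {x, y}"
        | i where "e = {(y # zs) ! i, (y # zs) ! Suc i}" "Suc i < length (y # zs)" by blast
      then show "e \<in> ?L"
      proof cases
        case 1
        then show ?thesis by (auto intro!: exI[of _ 0])
      next
        case 2
        then show ?thesis by (auto intro!: exI[of _ "Suc i"])
      qed
    qed
  qed
  then show ?case using 1 by simp
qed auto

lemma path_edges_subset_iff_successively:
  "path_edges p \<subseteq> E \<longleftrightarrow> successively (\<lambda>u v. {u, v} \<in> E) p"
  by (induction p rule: path_edges.induct) auto

lemma path_edges_subset_set: "e \<in> path_edges p \<Longrightarrow> e \<subseteq> set p"
  by (induction p rule: path_edges.induct) auto

lemma cycle_edges_conv_path_edges: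
  assumes "2 \<le> length p"
  shows "cycle_edges p = insert {last p, hd p} (path_edges p)"
proof -
  have ne: "p \<noteq> []" using assms by auto
  have "cycle_edges p = (\<lambda>i. {p ! i, p ! (Suc i mod length p)}) ` {..<length p}"
    by (auto simp: cycle_edges_def)
  also have "{..<length p} = insert (length p - 1) {i. Suc i < length p}"
    using assms by auto
  also have "(\<lambda>i. {p ! i, p ! (Suc i mod length p)}) ` \<dots> = 
      insert {last p, hd p} ((\<lambda>i. {p ! i, p ! Suc i}) ` {i. Suc i < length p})"
    using ne by (auto simp: last_conv_nth hd_conv_nth)
  finally show ?thesis by (auto simp: path_edges_conv_nth)
qed

text \<open>For a list of two vertices the closing edge is the path edge itself, hence the bound on
  the length.\<close>

lemma closing_edge_notin_path_edges:
  assumes "distinct p" "3 \<le> length p"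
  shows "{last p, hd p} \<notin> path_edges p"
proof
  assume *: "{last p, hd p} \<in> path_edges p"
  have ne: "p \<noteq> []" using assms(2) by auto
  obtain i where i: "Suc i < length p" "{last p, hd p} = {p ! i, p ! Suc i}"
    using * unfolding path_edges_conv_nth by blast
  have "last p = p ! (length p - 1)" "hd p = p ! 0" using ne by (simp_all add: last_conv_nth hd_conv_nth)
  then consider "p ! (length p - 1) = p ! i" "p ! 0 = p ! Suc i"
    | "p ! (length p - 1) = p ! Suc i" "p ! 0 = p ! i"
    using i(2) by (metis doubleton_eq_iff)
  then show False
  proof cases
    case 1
    then have "Suc i = 0" using i(1) ne assms nth_eq_iff_index_eq[of p 0 "Suc i"] by simp
    then show ?thesis by simp
  next
    case 2
    then have "i = 0" "length p - 1 = Suc i"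
      using i(1) ne assms nth_eq_iff_index_eq[of p 0 i]
        nth_eq_iff_index_eq[of p "length p - 1" "Suc i"] by simp_all
    then show ?thesis using assms(2) by simp
  qed
qed

text \<open>Separates the planar topology from the 1-complex: the Jordan curve arguments use only
  that edges are arcs between vertex points and that distinct edges meet in their common
  vertices.\<close>

locale arc_graph =
  fixes V :: "'v set" and E :: "'v set set" and P :: "'v \<Rightarrow> complex" and A :: "'v set \<Rightarrow> complex set"
  assumes graph: "graph V E"
    and inj: "inj_on P V"
    and edge_arc: "{u, v} \<in> E \<Longrightarrow>
      \<exists>g. arc g \<and> pathstart g = P u \<and> pathfinish g = P v \<and> path_image g = A {u, v}"
    and edges_Int: "e \<in> E \<Longrightarrow> e' \<in> E \<Longrightarrow> e \<noteq> e' \<Longrightarrow> A e \<inter> A e' = P ` (e \<inter> e')"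
begin

definition points :: "complex set" where
  "points = P ` V \<union> \<Union>(A ` E)"

text \<open>The face is kept beside its triangle because the parity count asks on which side of a
  cycle the face lies.\<close>

definition facial :: "'v set set \<Rightarrow> complex set \<Rightarrow> bool" where
  "facial T F \<longleftrightarrow> T \<subseteq> E \<and> (\<exists>a b c. distinct [a, b, c] \<and> T = {{a, b}, {b, c}, {c, a}}) \<and>
     F \<in> components (- points) \<and> frontier F = \<Union>(A ` T)"

lemma facialD:
  assumes "facial T F"
  shows "T \<subseteq> E" "F \<in> components (- points)" "frontier F = \<Union>(A ` T)"
  using assms by (simp_all add: facial_def)

lemma edgeE:
  assumes "e \<in> E"
  obtains u v where "e = {u, v}" "u \<noteq> v" "u \<in> V" "v \<in> V"
  using assms graph by (auto simp: graph_def card_2_iff)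

lemma edge_interior_nonempty:
  assumes "e \<in> E"
  obtains p where "p \<in> A e" "p \<notin> P ` e"
proof -
  obtain u v where e: "e = {u, v}" using assms edgeE by blast
  obtain g where "arc g" "pathstart g = P u" "pathfinish g = P v" "path_image g = A {u, v}"
    using edge_arc assms e by blast
  then show thesis
    using that nonempty_simple_path_endless[OF arc_imp_simple_path, of g] e by auto
qed

lemma edge_interior_unique:
  assumes "e \<in> E" "e' \<in> E" "p \<in> A e" "p \<notin> P ` e" "p \<in> A e'"
  shows "e' = e"
  using edges_Int[of e e'] assms by blast

text \<open>An interior point of an edge lies on no other edge, so a union of arcs determines its
  edges. In particular a face is bounded by at most one triangle.\<close>

lemma edge_sets_eqI:
  assumes "S \<subseteq> E" "T \<subseteq> E" "\<Union>(A ` S) = \<Union>(A ` T)"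
  shows "S = T"
proof -
  have "S \<subseteq> T" if "S \<subseteq> E" "T \<subseteq> E" "\<Union>(A ` S) \<subseteq> \<Union>(A ` T)" for S T
  proof
    fix e assume e: "e \<in> S"
    then have "e \<in> E" using that(1) by blast
    then obtain p where p: "p \<in> A e" "p \<notin> P ` e" by (rule edge_interior_nonempty)
    then obtain e' where "e' \<in> T" "p \<in> A e'" using e \<open>\<Union>(A ` S) \<subseteq> \<Union>(A ` T)\<close> by blast
    then show "e \<in> T" using edge_interior_unique[of e e' p] p \<open>e \<in> E\<close> \<open>T \<subseteq> E\<close> by blast
  qed
  from this[of S T] this[of T S] show ?thesis using assms by (simp add: subset_antisym)
qed

lemma arc_along_path:
  assumes "distinct p" "path_edges p \<subseteq> E" "set p \<subseteq> V" "2 \<le> length p"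
  shows "\<exists>g. arc g \<and> pathstart g = P (hd p) \<and> pathfinish g = P (last p) \<and>
    path_image g = \<Union>(A ` path_edges p)"
  using assms
proof (induction p rule: path_edges.induct)
  case (1 x y zs)
  obtain g where g: "arc g" "pathstart g = P x" "pathfinish g = P y" "path_image g = A {x, y}"
    using edge_arc[of x y] "1.prems"(2) by auto
  show ?case
  proof (cases zs)
    case Nil
    then show ?thesis using g by auto
  next
    case (Cons z zs')
    then obtain h where h: "arc h" "pathstart h = P y" "pathfinish h = P (last (y # zs))"
      "path_image h = \<Union>(A ` path_edges (y # zs))"
      using "1.IH" "1.prems" by auto
    have "A {x, y} \<inter> A e \<subseteq> {P y}" if "e \<in> path_edges (y # zs)" for e
    proof -
      have "x \<notin> e" using path_edges_subset_set[OF that] "1.prems"(1) by auto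
      then have "A {x, y} \<inter> A e = P ` ({x, y} \<inter> e)"
        using "1.prems"(2) that by (intro edges_Int) auto
      then show ?thesis using \<open>x \<notin> e\<close> by auto
    qed
    then have "path_image g \<inter> path_image h \<subseteq> {pathstart h}"
      unfolding g(4) h(4) h(2) by blast
    then have "arc (g +++ h)" using g h by (intro arc_join) auto
    then show ?thesis
      using g h Cons by (intro exI[of _ "g +++ h"]) (auto simp: path_image_join)
  qed
qed auto

lemma jordan_curve_cycle:
  assumes "is_cycle V E p"
  shows "jordan_curve (\<Union>(A ` cycle_edges p))"
proof -
  have p: "3 \<le> length p" "distinct p" "set p \<subseteq> V" and pE: "cycle_edges p \<subseteq> E"
    using assms by (auto simp: is_cycle_def)
  have c: "cycle_edges p = insert {last p, hd p} (path_edges p)"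
    using p(1) by (intro cycle_edges_conv_path_edges) simp
  obtain g where g: "arc g" "pathstart g = P (hd p)" "pathfinish g = P (last p)"
    "path_image g = \<Union>(A ` path_edges p)"
    using arc_along_path p pE c by force
  obtain h where h: "arc h" "pathstart h = P (last p)" "pathfinish h = P (hd p)"
    "path_image h = A {last p, hd p}"
    using edge_arc pE c by force
  have "A e \<inter> A {last p, hd p} \<subseteq> {P (last p), P (hd p)}" if "e \<in> path_edges p" for e
    using edges_Int[of e "{last p, hd p}"] that pE c closing_edge_notin_path_edges[OF p(2,1)] by auto
  then have "path_image g \<inter> path_image h \<subseteq> {pathstart g, pathstart h}"
    unfolding g(4) h(4) h(2) g(2) by blast
  then have "simple_path (g +++ h)" using g h by (intro simple_path_join_loop) auto
  then show ?thesis
    unfolding jordan_curve_def using g h c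
    by (intro exI[of _ "g +++ h"]) (auto simp: path_image_join)
qed

section \<open>The two faces at an edge\<close>

lemma facial_edgeE:
  assumes "facial T F" "{u, v} \<in> T"
  obtains c where "distinct [u, v, c]" "T = {{u, v}, {u, c}, {c, v}}"
proof -
  obtain a b c where *: "distinct [a, b, c]" "T = {{a, b}, {b, c}, {c, a}}"
    using assms by (auto simp: facial_def)
  then consider "{u, v} = {a, b}" | "{u, v} = {b, c}" | "{u, v} = {c, a}" using assms(2) by blast
  then show thesis
  proof cases
    case 1
    then show ?thesis using * that[of c] by (auto simp: doubleton_eq_iff insert_commute)
  next
    case 2
    then show ?thesis using * that[of a] by (auto simp: doubleton_eq_iff insert_commute)
  next
    case 3
    then show ?thesis using * that[of b] by (auto simp: doubleton_eq_iff insert_commute)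
  qed
qed

text \<open>Distinct triangles on \<open>e\<close> have distinct third vertices. So they form a
  theta graph whose middle arc is \<open>e\<close> and whose other two arcs run through these
  vertices.\<close>

lemma open_faces_at_edge:
  assumes "facial S F" "facial T G" "S \<noteq> T" "e \<in> S" "e \<in> T"
  shows "open (F \<union> (A e - P ` e) \<union> G)"
proof -
  have eE: "e \<in> E" using facialD(1) assms(1,4) by blast
  obtain u v where e: "e = {u, v}" "u \<noteq> v" "u \<in> V" "v \<in> V" using eE edgeE by blast
  obtain c where c: "distinct [u, v, c]" "S = {{u, v}, {u, c}, {c, v}}"
    using facial_edgeE[of S F u v] assms(1,4) e(1) by metis
  obtain d where d: "distinct [u, v, d]" "T = {{u, v}, {u, d}, {d, v}}"
    using facial_edgeE[of T G u v] assms(2,5) e(1) by metis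
  have "c \<noteq> d" using c d assms(3) by auto
  have E: "{u, v} \<in> E" "{u, c} \<in> E" "{c, v} \<in> E" "{u, d} \<in> E" "{d, v} \<in> E"
    using facialD(1)[OF assms(1)] facialD(1)[OF assms(2)] c d by auto
  then have cd: "c \<in> V" "d \<in> V" using graph by (auto simp: graph_def)
  obtain g where g: "arc g" "pathstart g = P u" "pathfinish g = P v" "path_image g = A {u, v}"
    using edge_arc E by blast
  obtain a where a: "arc a" "pathstart a = P u" "pathfinish a = P v"
    "path_image a = A {u, c} \<union> A {c, v}"
    using arc_along_path[of "[u, c, v]"] E c e cd by auto
  obtain b where b: "arc b" "pathstart b = P u" "pathfinish b = P v"
    "path_image b = A {u, d} \<union> A {d, v}"
    using arc_along_path[of "[u, d, v]"] E d e cd by auto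
  have i: "A {u, v} \<inter> A {u, c} = {P u}" "A {u, v} \<inter> A {c, v} = {P v}"
    "A {u, v} \<inter> A {u, d} = {P u}" "A {u, v} \<inter> A {d, v} = {P v}"
    "A {u, c} \<inter> A {u, d} = {P u}" "A {u, c} \<inter> A {d, v} = {}"
    "A {c, v} \<inter> A {u, d} = {}" "A {c, v} \<inter> A {d, v} = {P v}"
    using c(1) d(1) e \<open>c \<noteq> d\<close> E by (subst edges_Int; auto simp: doubleton_eq_iff)+
  have sub: "A e' \<subseteq> points" if "e' \<in> E" for e' using that by (auto simp: points_def)
  have "open (F \<union> (path_image g - {P u, P v}) \<union> G)"
  proof (rule theta_component[where a = a and b = b and X = points])
    show "frontier F = path_image g \<union> path_image a" "frontier G = path_image g \<union> path_image b"
      using facialD(3)[OF assms(1)] facialD(3)[OF assms(2)] c d g a b by auto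
    show "F \<in> components (- points)" "G \<in> components (- points)"
      using facialD(2) assms(1,2) by auto
  qed (use g a b i E sub in \<open>simp_all add: Int_Un_distrib Int_Un_distrib2 insert_commute\<close>)
  then show ?thesis using g e by simp
qed

text \<open>The face of any facial triangle through \<open>e\<close> accumulates at an interior
  point of \<open>e\<close>. Hence it meets the open set around that point, and since it avoids
  \<open>e\<close> it must be \<open>F\<close> or \<open>G\<close>.\<close>

lemma faces_at_edge:
  assumes tri: "\<exists>S T F G. S \<noteq> T \<and> facial S F \<and> facial T G \<and> e \<in> S \<and> e \<in> T"
  obtains S T F G where "S \<noteq> T" "facial S F" "facial T G" "e \<in> S" "e \<in> T"
    "open (F \<union> (A e - P ` e) \<union> G)"
    "\<And>R H. facial R H \<Longrightarrow> e \<in> R \<Longrightarrow> R = S \<and> H = F \<or> R = T \<and> H = G"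
proof -
  obtain S T F G where st: "S \<noteq> T" "facial S F" "facial T G" "e \<in> S" "e \<in> T" using tri by blast
  have o: "open (F \<union> (A e - P ` e) \<union> G)" using open_faces_at_edge st by blast
  have eE: "e \<in> E" using facialD(1) st by blast
  obtain p where p: "p \<in> A e" "p \<notin> P ` e" using edge_interior_nonempty[OF eE] .
  have eq: "R = R'" if "facial R H" "facial R' H" for R R' H
    using edge_sets_eqI[of R R'] facialD(1,3)[OF that(1)] facialD(1,3)[OF that(2)] by auto
  have "R = S \<and> H = F \<or> R = T \<and> H = G" if RH: "facial R H" "e \<in> R" for R H
  proof -
    have "p \<in> closure H" using facialD(3)[OF RH(1)] p RH(2) by (auto simp: frontier_def)
    moreover have "p \<in> F \<union> (A e - P ` e) \<union> G" using p by blast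
    ultimately have "H \<inter> (F \<union> (A e - P ` e) \<union> G) \<noteq> {}"
      using o by (metis Int_commute open_Int_closure_eq_empty disjoint_iff)
    moreover have "H \<inter> A e = {}"
      using in_components_subset[OF facialD(2)[OF RH(1)]] eE by (auto simp: points_def)
    ultimately have "H \<inter> F \<noteq> {} \<or> H \<inter> G \<noteq> {}" by blast
    then have "H = F \<or> H = G"
      using components_eq[OF facialD(2)[OF RH(1)] facialD(2)[OF st(2)]]
        components_eq[OF facialD(2)[OF RH(1)] facialD(2)[OF st(3)]] by blast
    then show ?thesis using eq RH(1) st(2,3) by blast
  qed
  then show thesis by (rule that[OF st o])
qed

text \<open>Double counting of pairs of an edge of \<open>D\<close> and a facial triangle through it
  whose face lies inside the curve. An edge has one such triangle if it is on the cycle, and none or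
  two otherwise; each triangle has an even number of edges in \<open>D\<close>.\<close>

lemma even_cocycle_on_cycle:
  assumes tri: "\<And>e. e \<in> E \<Longrightarrow> \<exists>S T F G. S \<noteq> T \<and> facial S F \<and> facial T G \<and> e \<in> S \<and> e \<in> T"
    and D: "finite D" "D \<subseteq> E" and even: "\<And>T F. facial T F \<Longrightarrow> even (card (D \<inter> T))"
    and Z: "is_cycle V E p"
  shows "even (card (D \<inter> cycle_edges p))"
proof -
  define J where "J = \<Union>(A ` cycle_edges p)"
  have ZE: "cycle_edges p \<subseteq> E" using Z by (simp add: is_cycle_def)
  have j: "jordan_curve J" unfolding J_def by (rule jordan_curve_cycle[OF Z])
  note s = jordan_curve_sides[OF j]
  have Jp: "J \<subseteq> points" using ZE by (auto simp: J_def points_def)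
  define I where "I e = {T. e \<in> T \<and> (\<exists>F. facial T F \<and> F \<subseteq> inside J)}" for e
  have side: "F \<subseteq> inside J \<or> F \<subseteq> outside J" if "facial T F" for T F
  proof -
    note c = facialD(2)[OF that]
    have "F \<subseteq> inside J \<union> outside J" using in_components_subset[OF c] Jp s(8) by blast
    then show ?thesis using connectedD[OF in_components_connected[OF c] s(1,2)] s(7) by blast
  qed
  have I: "finite (I e) \<and> (odd (card (I e)) \<longleftrightarrow> e \<in> cycle_edges p)" if e: "e \<in> E" for e
  proof -
    obtain S T F G where st: "S \<noteq> T" "facial S F" "facial T G" "e \<in> S" "e \<in> T"
      and o: "open (F \<union> (A e - P ` e) \<union> G)"
      and uniq: "\<And>R H. facial R H \<Longrightarrow> e \<in> R \<Longrightarrow> R = S \<and> H = F \<or> R = T \<and> H = G"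
      using faces_at_edge[OF tri[OF e]] by blast
    obtain q where q: "q \<in> A e" "q \<notin> P ` e" using edge_interior_nonempty[OF e] .
    have Ie: "R \<in> I e \<longleftrightarrow> R = S \<and> F \<subseteq> inside J \<or> R = T \<and> G \<subseteq> inside J" for R
      using uniq st unfolding I_def by blast
    have ne: "F \<noteq> {}" "G \<noteq> {}"
      using in_components_nonempty[OF facialD(2)[OF st(2)]] in_components_nonempty[OF facialD(2)[OF st(3)]] .
    have fF: "q \<in> closure F" "q \<in> closure G"
      using facialD(3)[OF st(2)] facialD(3)[OF st(3)] q st(4,5) by (auto simp: frontier_def)
    show ?thesis
    proof (cases "e \<in> cycle_edges p")
      case True
      then have eJ: "A e \<subseteq> J" by (auto simp: J_def)
      \<comment> \<open>Both sides accumulate at \<open>q\<close>, so the open set around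
        \<open>q\<close> meets both. Its edge part lies on \<open>J\<close>, so one face is inside
        and the other outside.\<close>
      have "q \<in> closure (inside J)" "q \<in> closure (outside J)"
        using s(9,10) eJ q by (auto simp: frontier_def)
      moreover have "q \<in> F \<union> (A e - P ` e) \<union> G" using q by blast
      ultimately have "(F \<union> (A e - P ` e) \<union> G) \<inter> inside J \<noteq> {}" "(F \<union> (A e - P ` e) \<union> G) \<inter> outside J \<noteq> {}"
        using o by (metis open_Int_closure_eq_empty disjoint_iff)+
      moreover have "A e \<inter> inside J = {}" "A e \<inter> outside J = {}" using eJ s(8) by blast+
      ultimately have "F \<inter> inside J \<noteq> {} \<or> G \<inter> inside J \<noteq> {}" "F \<inter> outside J \<noteq> {} \<or> G \<inter> outside J \<noteq> {}"
        by blast+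
      then have "F \<subseteq> inside J \<and> \<not> G \<subseteq> inside J \<or> \<not> F \<subseteq> inside J \<and> G \<subseteq> inside J"
        using side[OF st(2)] side[OF st(3)] s(7) ne by blast
      then have "I e = {S} \<or> I e = {T}" using Ie by blast
      then show ?thesis using True by auto
    next
      case False
      \<comment> \<open>An interior point of an edge off the cycle is off the curve. Both faces
        accumulate there, hence lie on the same side.\<close>
      have "q \<notin> J"
      proof
        assume "q \<in> J"
        then obtain e' where "e' \<in> cycle_edges p" "q \<in> A e'" by (auto simp: J_def)
        then show False using edge_interior_unique[OF e _ q, of e'] ZE False by blast
      qed
      then have "q \<in> inside J \<or> q \<in> outside J" using s(8) by blast
      then have "(F \<subseteq> inside J \<and> G \<subseteq> inside J) \<or> (\<not> F \<subseteq> inside J \<and> \<not> G \<subseteq> inside J)"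
      proof
        assume "q \<in> inside J"
        then have "inside J \<inter> F \<noteq> {}" "inside J \<inter> G \<noteq> {}"
          using fF s(1) by (metis open_Int_closure_eq_empty disjoint_iff)+
        then show ?thesis using side[OF st(2)] side[OF st(3)] s(7) by blast
      next
        assume "q \<in> outside J"
        then have "outside J \<inter> F \<noteq> {}" "outside J \<inter> G \<noteq> {}"
          using fF s(2) by (metis open_Int_closure_eq_empty disjoint_iff)+
        then show ?thesis using side[OF st(2)] side[OF st(3)] s(7) by blast
      qed
      then have "I e = {S, T} \<or> I e = {}" using Ie by blast
      then have "finite (I e) \<and> even (card (I e))" using st(1) by (elim disjE) simp_all
      then show ?thesis using False by blast
    qed
  qed
  \<comment> \<open>Only triangles with an edge in \<open>D\<close> are summed, which keeps the sum
    finite even if infinitely many triangles lie inside.\<close>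
  define K where "K = (\<Union>e\<in>D. I e)"
  have K: "finite K" using I D by (auto simp: K_def)
  have "I e = {T \<in> K. e \<in> T}" if "e \<in> D" for e
    using that by (auto simp: K_def I_def)
  then have "(\<Sum>e\<in>D. card (I e)) = (\<Sum>e\<in>D. card {T \<in> K. e \<in> T})" by simp
  also have "\<dots> = (\<Sum>T\<in>K. card {e \<in> D. e \<in> T})"
    by (rule sum_multicount_gen) (use D K in auto)
  also have "\<dots> = (\<Sum>T\<in>K. card (D \<inter> T))" by (simp add: Int_def)
  finally have eq: "(\<Sum>e\<in>D. card (I e)) = (\<Sum>T\<in>K. card (D \<inter> T))" .
  have "even (card (D \<inter> T))" if "T \<in> K" for T
    using that even by (auto simp: K_def I_def)
  then have "even (\<Sum>e\<in>D. card (I e))" unfolding eq by (rule dvd_sum)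
  \<comment> \<open>A sum is even iff it has an even number of odd terms; here the odd terms belong
    to the edges of the cycle.\<close>
  then have "even (card {e \<in> D. odd (card (I e))})" 
    by (simp only: even_sum_iff[OF D(1)])
  moreover have "{e \<in> D. odd (card (I e))} = D \<inter> cycle_edges p"
    using I D(2) by (auto dest: subsetD)
  ultimately show ?thesis by simp
qed

end

section \<open>Graph distance\<close>

text \<open>Distances are computed with powers of this relation, which compose freely, whereas
  joining two simple paths need not give a simple path.\<close>

definition adj :: "'v set set \<Rightarrow> ('v \<times> 'v) set" where
  "adj E = {(u, v). {u, v} \<in> E}"

lemma adj_iff: "(u, v) \<in> adj E \<longleftrightarrow> {u, v} \<in> E"
  by (simp add: adj_def)

lemma adj_commute: "(u, v) \<in> adj E \<longleftrightarrow> (v, u) \<in> adj E"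
  by (simp add: adj_def insert_commute)

text \<open>The closure is reflexive everywhere, so a vertex outside \<open>S\<close> is linked to
  itself; membership in \<open>S\<close> has to be stated separately.\<close>

abbreviation linked :: "'v set set \<Rightarrow> 'v set \<Rightarrow> ('v \<times> 'v) set" where
  "linked E S \<equiv> (adj E \<inter> S \<times> S)\<^sup>*"

lemma linked_commute: "(x, y) \<in> linked E S \<Longrightarrow> (y, x) \<in> linked E S"
proof -
  have "sym (adj E \<inter> S \<times> S)" by (auto simp: sym_def adj_commute)
  then show "(x, y) \<in> linked E S \<Longrightarrow> (y, x) \<in> linked E S"
    using sym_rtrancl by (meson symE)
qed

lemma linked_mono: "(x, y) \<in> linked E S \<Longrightarrow> S \<subseteq> T \<Longrightarrow> (x, y) \<in> linked E T"
  using rtrancl_mono[of "adj E \<inter> S \<times> S" "adj E \<inter> T \<times> T"] by blast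

lemma linked_in: "(x, y) \<in> linked E S \<Longrightarrow> x \<in> S \<Longrightarrow> y \<in> S"
  by (induction rule: rtrancl_induct) auto

lemma linked_edge: "{x, y} \<in> E \<Longrightarrow> x \<in> S \<Longrightarrow> y \<in> S \<Longrightarrow> (x, y) \<in> linked E S"
  by (auto simp: adj_iff)

text \<open>Cutting out the part between two visits of a vertex shortens a walk. This leads from
  relation powers back to the simple paths of \<open>graph_dist\<close>.\<close>

lemma walk_imp_path_between:
  assumes "p \<noteq> []" "set p \<subseteq> S" "successively (\<lambda>u v. {u, v} \<in> E) p"
  shows "\<exists>q. path_between S E (hd p) (last p) q \<and> length q \<le> length p"
  using assms
proof (induction "length p" arbitrary: p rule: less_induct)
  case less
  show ?case
  proof (cases "distinct p")
    case True
    then show ?thesis using less.prems by (intro exI[of _ p]) (simp add: path_between_def)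
  next
    case False
    then obtain xs ys zs y where p: "p = xs @ [y] @ ys @ [y] @ zs"
      using not_distinct_decomp by blast
    let ?q = "xs @ [y] @ zs"
    have "successively (\<lambda>u v. {u, v} \<in> E) ?q"
      using less.prems(3) unfolding p by (auto simp: successively_append_iff successively_Cons split: if_splits)
    moreover have "length ?q < length p" "set ?q \<subseteq> S" "hd ?q = hd p" "last ?q = last p"
      using less.prems(2) unfolding p by (auto simp: hd_append)
    ultimately show ?thesis using less.hyps[of ?q] by fastforce
  qed
qed

lemma relpow_adj_imp_walk:
  "(x, y) \<in> (adj E \<inter> S \<times> S) ^^ n \<Longrightarrow> x \<in> S \<Longrightarrow>
    \<exists>p. p \<noteq> [] \<and> hd p = x \<and> last p = y \<and> set p \<subseteq> S \<and> successively (\<lambda>u v. {u, v} \<in> E) p \<and> length p = Suc n"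
proof (induction n arbitrary: y)
  case 0
  then show ?case by (intro exI[of _ "[x]"]) auto
next
  case (Suc n)
  then obtain z where z: "(x, z) \<in> (adj E \<inter> S \<times> S) ^^ n" "{z, y} \<in> E" "y \<in> S"
    by (auto simp: adj_iff)
  then obtain p where p: "p \<noteq> []" "hd p = x" "last p = z" "set p \<subseteq> S"
    "successively (\<lambda>u v. {u, v} \<in> E) p" "length p = Suc n"
    using Suc by blast
  then show ?case
    using z by (intro exI[of _ "p @ [y]"]) (auto simp: successively_append_iff)
qed

lemma relpow_adj_imp_path_between:
  assumes "(x, y) \<in> (adj E \<inter> S \<times> S) ^^ n" "x \<in> S"
  shows "\<exists>p. path_between S E x y p \<and> length p \<le> Suc n"
  using relpow_adj_imp_walk[OF assms] walk_imp_path_between by metis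

lemma path_between_imp_relpow_adj:
  assumes "path_between S E x y p"
  shows "(x, y) \<in> (adj E \<inter> S \<times> S) ^^ (length p - 1)"
proof -
  have "(hd p, last p) \<in> (adj E \<inter> S \<times> S) ^^ (length p - 1)"
    if "p \<noteq> []" "set p \<subseteq> S" "successively (\<lambda>u v. {u, v} \<in> E) p"
    using that
  proof (induction p rule: rev_nonempty_induct)
    case (snoc y p)
    then have "(hd p, last p) \<in> (adj E \<inter> S \<times> S) ^^ (length p - 1)" "(last p, y) \<in> adj E \<inter> S \<times> S"
      by (auto simp: successively_append_iff adj_iff)
    then have "(hd p, y) \<in> (adj E \<inter> S \<times> S) ^^ Suc (length p - 1)" by auto
    moreover have "Suc (length p - 1) = length (p @ [y]) - 1" using snoc by simp
    ultimately show ?case using snoc(1) by simp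
  qed simp
  then show ?thesis using assms by (auto simp: path_between_def)
qed

lemma linked_iff_path_between:
  assumes "x \<in> S"
  shows "(x, y) \<in> linked E S \<longleftrightarrow> (\<exists>p. path_between S E x y p)"
  using relpow_adj_imp_path_between[OF _ assms] path_between_imp_relpow_adj
  by (metis rtrancl_power)

lemma path_edges_append:
  "p \<noteq> [] \<Longrightarrow> q \<noteq> [] \<Longrightarrow> path_edges (p @ q) = path_edges p \<union> {{last p, hd q}} \<union> path_edges q"
proof (induction p rule: path_edges.induct)
  case (1 x y zs)
  then show ?case by auto
next
  case ("2_2" v)
  then show ?case by (cases q) auto
qed auto

text \<open>The cyclic predecessor and successor differ because the length is at least 3. Applied to
  a highest vertex of a supposed cycle of classes.\<close>

lemma cycle_neighbours:
  assumes "is_cycle V E p" "v \<in> set p"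
  obtains u w where "u \<noteq> w" "u \<in> set p" "w \<in> set p" "{u, v} \<in> E" "{v, w} \<in> E"
proof -
  define n where "n = length p"
  have n: "3 \<le> n" and d: "distinct p" and E: "\<And>i. i < n \<Longrightarrow> {p ! i, p ! (Suc i mod n)} \<in> E"
    using assms(1) by (auto simp: is_cycle_def cycle_edges_def n_def)
  obtain i where i: "i < n" "v = p ! i" using assms(2) by (auto simp: in_set_conv_nth n_def)
  define j where "j = (if i = 0 then n - 1 else i - 1)"
  define k where "k = (if Suc i = n then 0 else Suc i)"
  have j: "j < n" "Suc j mod n = i" and k: "k < n" "Suc i mod n = k" and "j \<noteq> k"
    using i(1) n by (auto simp: j_def k_def)
  then have "p ! j \<noteq> p ! k" using d by (simp add: n_def nth_eq_iff_index_eq)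
  moreover have "{p ! j, v} \<in> E" "{v, p ! k} \<in> E" using E[OF j(1)] E[OF i(1)] j k i by auto
  ultimately show thesis using that[of "p ! j" "p ! k"] j k by (auto simp: n_def)
qed

section \<open>Graph distance in a connected graph\<close>

locale conn_graph =
  fixes V :: "'v set" and E :: "'v set set"
  assumes connected: "connected_graph V E"
begin

abbreviation d :: "'v \<Rightarrow> 'v \<Rightarrow> nat" where "d \<equiv> graph_dist V E"

lemma edge_in: "{u, v} \<in> E \<Longrightarrow> u \<in> V" "{u, v} \<in> E \<Longrightarrow> v \<in> V"
  using connected by (fastforce simp: connected_graph_def graph_def)+

lemma adj_within: "adj E \<inter> V \<times> V = adj E"
  using edge_in by (auto simp: adj_iff)

lemma dist_relpow:
  assumes "x \<in> V" "y \<in> V"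
  shows "(x, y) \<in> adj E ^^ d x y"
proof -
  have "\<exists>n p. path_between V E x y p \<and> n = length p - 1"
    using connected assms by (auto simp: connected_graph_def)
  then have "\<exists>p. path_between V E x y p \<and> d x y = length p - 1"
    unfolding graph_dist_def by (rule LeastI_ex)
  then show ?thesis using path_between_imp_relpow_adj adj_within by metis
qed

lemma dist_le_relpow:
  assumes "(x, y) \<in> adj E ^^ n" "x \<in> V"
  shows "d x y \<le> n"
proof -
  obtain p where p: "path_between V E x y p" "length p \<le> Suc n"
    using relpow_adj_imp_path_between[of x y n E V] assms adj_within by auto
  have "d x y \<le> length p - 1"
    unfolding graph_dist_def by (rule Least_le) (use p in blast)
  then show ?thesis using p by simp
qed

lemma dist_self: "x \<in> V \<Longrightarrow> d x x = 0"
  using dist_le_relpow[of x x 0] by simp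

lemma dist_eq_0: "x \<in> V \<Longrightarrow> y \<in> V \<Longrightarrow> d x y = 0 \<longleftrightarrow> x = y"
  using dist_relpow[of x y] dist_self by auto

lemma dist_triangle: "x \<in> V \<Longrightarrow> y \<in> V \<Longrightarrow> z \<in> V \<Longrightarrow> d x z \<le> d x y + d y z"
  using dist_relpow[of x y] dist_relpow[of y z] by (intro dist_le_relpow) (auto simp: relpow_add)

lemma relpow_adj_commute: "(x, y) \<in> adj E ^^ n \<Longrightarrow> (y, x) \<in> adj E ^^ n"
proof (induction n arbitrary: y)
  case (Suc n)
  then obtain z where "(x, z) \<in> adj E ^^ n" "(z, y) \<in> adj E" by auto
  then have "(z, x) \<in> adj E ^^ n" "(y, z) \<in> adj E" using Suc.IH adj_commute[of y z E] by auto
  then show ?case by (meson relpow_Suc_I2)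
qed auto

lemma dist_commute: "x \<in> V \<Longrightarrow> y \<in> V \<Longrightarrow> d x y = d y x"
  using dist_relpow dist_le_relpow relpow_adj_commute by (metis le_antisym)

lemma dist_edge: "{x, y} \<in> E \<Longrightarrow> d x y \<le> 1"
  using dist_le_relpow[of x y 1] edge_in by (auto simp: adj_iff)

lemma dist_edge_le: "{y, z} \<in> E \<Longrightarrow> x \<in> V \<Longrightarrow> d x z \<le> Suc (d x y)"
  using dist_triangle[of x y z] dist_edge[of y z] edge_in by fastforce

lemma predecessor:
  assumes "x \<in> V" "y \<in> V" "x \<noteq> y"
  obtains z where "{z, y} \<in> E" "d x y = Suc (d x z)"
proof -
  obtain n where n: "d x y = Suc n" using dist_eq_0 assms by (metis not0_implies_Suc)
  then obtain z where z: "(x, z) \<in> adj E ^^ n" "{z, y} \<in> E"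
    using dist_relpow[OF assms(1,2)] by (auto simp: adj_iff)
  have "d x z \<le> n" using dist_le_relpow z(1) assms by blast
  moreover have "Suc n \<le> Suc (d x z)" using dist_edge_le[OF z(2) assms(1)] n by simp
  ultimately show thesis using that z n by simp
qed

text \<open>A discrete intermediate value theorem: one step raises the distance from
  \<open>x\<close> by at most 1. The walk stays in \<open>S\<close>, but \<open>d\<close> is the
  distance in the whole graph.\<close>

lemma linked_attains_dist:
  assumes "(x, y) \<in> linked E S" "x \<in> S" "S \<subseteq> V" "k \<le> d x y"
  shows "\<exists>z\<in>S. d x z = k"
  using assms
proof (induction rule: rtrancl_induct)
  case base
  then show ?case using dist_self by fastforce
next
  case (step y z)
  show ?case
  proof (cases "k \<le> d x y")
    case True
    then show ?thesis using step by blast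
  next
    case False
    moreover have "d x z \<le> Suc (d x y)"
      using step dist_edge_le[of y z x] by (auto simp: adj_iff)
    ultimately have "d x z = k" using step.prems by simp
    then show ?thesis using step by auto
  qed
qed

lemma finite_ball:
  assumes lf: "\<And>u. u \<in> V \<Longrightarrow> finite {v. {u, v} \<in> E}" and x: "x \<in> V"
  shows "finite (graph_ball V E x n)"
proof (induction n)
  case 0
  have "graph_ball V E x 0 \<subseteq> {x}" using dist_eq_0 x by (auto simp: graph_ball_def)
  then show ?case using finite_subset by blast
next
  case (Suc n)
  have "graph_ball V E x (Suc n) \<subseteq> insert x (\<Union>u\<in>graph_ball V E x n. {v. {u, v} \<in> E})"
  proof
    fix v assume v: "v \<in> graph_ball V E x (Suc n)"
    show "v \<in> insert x (\<Union>u\<in>graph_ball V E x n. {v. {u, v} \<in> E})"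
    proof (cases "v = x")
      case False
      then obtain z where "{z, v} \<in> E" "d x v = Suc (d x z)"
        using predecessor[of x v] x v by (auto simp: graph_ball_def)
      then show ?thesis using v edge_in[of z v] by (auto simp: graph_ball_def)
    qed simp
  qed
  moreover have "finite (\<Union>u\<in>graph_ball V E x n. {v. {u, v} \<in> E})"
    using Suc lf by (intro finite_UN_I) (auto simp: graph_ball_def)
  ultimately show ?case using finite_subset by blast
qed

end

section \<open>Levels\<close>

locale rooted_graph = conn_graph V E for V :: "'v set" and E :: "'v set set" +
  fixes root :: 'v
  assumes root_in: "root \<in> V"
    and locally_finite: "\<And>u. u \<in> V \<Longrightarrow> finite {v. {u, v} \<in> E}"
begin

abbreviation lev :: "'v \<Rightarrow> nat" where "lev \<equiv> d root"

definition level :: "nat \<Rightarrow> 'v set" where "level n = {v \<in> V. lev v = n}"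

definition above :: "nat \<Rightarrow> 'v set" where "above n = {v \<in> V. n \<le> lev v}"

definition sim :: "'v \<Rightarrow> 'v \<Rightarrow> bool" where
  "sim x y \<longleftrightarrow> lev x = lev y \<and> (x, y) \<in> linked E (above (lev x))"

lemma sim_refl: "sim x x"
  by (simp add: sim_def)

lemma sim_sym: "sim x y \<Longrightarrow> sim y x"
  by (auto simp: sim_def intro: linked_commute)

lemma sim_trans: "sim x y \<Longrightarrow> sim y z \<Longrightarrow> sim x z"
  by (auto simp: sim_def)

lemma lev_root: "lev root = 0"
  using dist_self root_in by simp

lemma lev_edge: "{u, v} \<in> E \<Longrightarrow> lev v \<le> Suc (lev u)"
  using dist_edge_le[of u v root] root_in by simp

lemma finite_level: "finite (level n)"
  using finite_ball[OF locally_finite root_in, of n]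
  by (rule rev_finite_subset) (auto simp: level_def graph_ball_def)

text \<open>Allows the classes to be named by natural numbers, the vertex type demanded of the
  tree.\<close>

lemma countable_vertices: "countable V"
proof -
  have "V = (\<Union>n. level n)" by (auto simp: level_def)
  then show ?thesis using finite_level by (metis countable_UN countable_finite countableI_type)
qed

section \<open>Descent towards the root\<close>

definition parent :: "'v \<Rightarrow> 'v" where
  "parent v = (SOME u. {u, v} \<in> E \<and> lev v = Suc (lev u))"

lemma parent:
  assumes "v \<in> V" "0 < lev v"
  shows "{parent v, v} \<in> E" "lev v = Suc (lev (parent v))"
proof -
  have "root \<noteq> v" using assms lev_root by auto
  then have "\<exists>u. {u, v} \<in> E \<and> lev v = Suc (lev u)"
    using predecessor root_in assms by metis
  then have "{parent v, v} \<in> E \<and> lev v = Suc (lev (parent v))"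
    unfolding parent_def by (rule someI_ex)
  then show "{parent v, v} \<in> E" "lev v = Suc (lev (parent v))" by auto
qed

definition anc :: "nat \<Rightarrow> 'v \<Rightarrow> 'v" where "anc i = parent ^^ i"

lemma anc_0: "anc 0 v = v"
  by (simp add: anc_def)

lemma anc:
  assumes "v \<in> V" "i \<le> lev v"
  shows "anc i v \<in> V \<and> lev (anc i v) = lev v - i"
  using assms(2)
proof (induction i)
  case (Suc i)
  then have "0 < lev (anc i v)" "anc i v \<in> V" "lev (anc i v) = lev v - i" by auto
  then show ?case using parent[of "anc i v"] edge_in by (auto simp: anc_def)
qed (simp add: anc_def assms(1))

lemma anc_edge:
  assumes "v \<in> V" "i < lev v"
  shows "{anc (Suc i) v, anc i v} \<in> E"
  using parent(1)[of "anc i v"] anc[of v i] assms by (auto simp: anc_def)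

lemma dist_anc:
  assumes "v \<in> V" "i + k \<le> lev v"
  shows "d (anc i v) (anc (i + k) v) \<le> k"
  using assms(2)
proof (induction k)
  case 0
  then show ?case using anc[of v i] assms by (simp add: dist_self)
next
  case (Suc k)
  then show ?case
    using anc_edge[of v "i + k"] dist_edge_le[of "anc (i + k) v" "anc (Suc (i + k)) v" "anc i v"] anc[of v i] assms(1)
    by (auto simp: insert_commute)
qed

lemma linked_anc:
  assumes "v \<in> V" "i \<le> lev v"
  shows "(anc i v, v) \<in> linked E (above (lev v - i))"
  using assms(2)
proof (induction i)
  case (Suc i)
  have "(anc i v, v) \<in> linked E (above (lev v - Suc i))"
    by (rule linked_mono[of _ _ E "above (lev v - i)"]) (use Suc in \<open>auto simp: above_def\<close>)
  moreover have "(anc (Suc i) v, anc i v) \<in> linked E (above (lev v - Suc i))"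
    using anc_edge[of v i] anc[of v i] anc[of v "Suc i"] Suc.prems assms(1)
    by (intro linked_edge) (auto simp: above_def)
  ultimately show ?case by (meson rtrancl_trans)
qed (simp add: anc_0)

text \<open>Supplies the connection that closes up a high path by a detour lying strictly below
  it.\<close>

lemma linked_root:
  assumes "v \<in> V"
  shows "(v, root) \<in> linked E {u \<in> V. lev u \<le> lev v}"
  using assms
proof (induction "lev v" arbitrary: v)
  case 0
  then have "v = root" using dist_eq_0 root_in by auto
  then show ?case by simp
next
  case (Suc n)
  then have p: "{parent v, v} \<in> E" "lev v = Suc (lev (parent v))" "parent v \<in> V"
    using parent[of v] edge_in by auto
  have "(parent v, root) \<in> linked E {u \<in> V. lev u \<le> lev (parent v)}"
    using Suc p by simp
  then have "(parent v, root) \<in> linked E {u \<in> V. lev u \<le> lev v}"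
    by (rule linked_mono) (use p(2) in auto)
  moreover have "(v, parent v) \<in> linked E {u \<in> V. lev u \<le> lev v}"
    using p Suc by (intro linked_edge) (auto simp: insert_commute)
  ultimately show ?case by (meson rtrancl_trans)
qed

text \<open>In a graph whose cycle space is generated by triangles, the edges leading down from a
  component of a level form a cut.\<close>

lemma sim_imp_linked_level:
  assumes cocycle: "\<And>D p. \<lbrakk>finite D; D \<subseteq> E;
      \<And>a b c. \<lbrakk>distinct [a, b, c]; {{a, b}, {b, c}, {c, a}} \<subseteq> E\<rbrakk> \<Longrightarrow> even (card (D \<inter> {{a, b}, {b, c}, {c, a}}));
      is_cycle V E p\<rbrakk> \<Longrightarrow> even (card (D \<inter> cycle_edges p))"
    and xy: "x \<in> V" "y \<in> V" "sim x y" and pos: "0 < lev x"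
  shows "(x, y) \<in> linked E (level (lev x))"
proof (rule ccontr)
  assume not: "(x, y) \<notin> linked E (level (lev x))"
  define n where "n = lev x"
  have ly: "lev y = n" and up: "(x, y) \<in> linked E (above n)" and n: "0 < n"
    using xy pos by (auto simp: sim_def n_def)
  define K where "K = {z. (x, z) \<in> linked E (level n)}"
  define M where "M = level (n - 1)"
  have xK: "x \<in> K" and yK: "y \<notin> K" using not by (auto simp: K_def n_def)
  have "x \<in> level n" using xy by (simp add: level_def n_def)
  then have Kn: "K \<subseteq> level n" using linked_in by (auto simp: K_def)
  define D where "D = {e \<in> E. \<exists>a\<in>K. \<exists>b\<in>M. e = {a, b}}"
  have "D \<subseteq> (\<lambda>(a, b). {a, b}) ` (level n \<times> M)" using Kn by (auto simp: D_def)
  then have "finite D" using finite_level by (auto simp: M_def intro: finite_subset)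
  have disj: "z \<notin> M" if "z \<in> K" for z using that Kn n by (auto simp: M_def level_def)
  have D: "{u, v} \<in> D \<longleftrightarrow> {u, v} \<in> E \<and> (u \<in> K \<and> v \<in> M \<or> v \<in> K \<and> u \<in> M)" for u v
    by (auto simp: D_def doubleton_eq_iff)
  \<comment> \<open>A common neighbour of vertices on levels \<open>n\<close> and
    \<open>n - 1\<close> lies on one of these levels; if on level \<open>n\<close>, its edge to
    \<open>a\<close> puts it into \<open>K\<close>.\<close>
  have third: "c \<in> K \<or> c \<in> M" if "a \<in> K" "b \<in> M" "{a, c} \<in> E" "{b, c} \<in> E" for a b c
  proof -
    have a: "lev a = n" "a \<in> V" and b: "lev b = n - 1" using that Kn by (auto simp: level_def M_def)
    have c: "c \<in> V" using that edge_in by blast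
    have "lev c \<le> n" "n \<le> Suc (lev c)"
      using lev_edge[of b c] lev_edge[of c a] that a b n by (auto simp: insert_commute)
    then consider "lev c = n - 1" | "lev c = n" by linarith
    then show ?thesis
    proof cases
      case 1
      then show ?thesis using c by (simp add: M_def level_def)
    next
      case 2
      then have "(a, c) \<in> linked E (level n)"
        using that a c by (intro linked_edge) (auto simp: level_def)
      then show ?thesis using that(1) by (auto simp: K_def)
    qed
  qed
  \<comment> \<open>The two vertices on the same side of the cut span the only edge of the triangle
    outside \<open>D\<close>.\<close>
  have two: "card (D \<inter> {{a, b}, {b, c}, {c, a}}) = 2"
    if abc: "distinct [a, b, c]" "{{a, b}, {b, c}, {c, a}} \<subseteq> E" and "a \<in> K" "b \<in> M" for a b c
  proof -
    have "c \<in> K \<or> c \<in> M" using third[of a b c] that by (auto simp: insert_commute)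
    then have "D \<inter> {{a, b}, {b, c}, {c, a}} = {{a, b}, {b, c}} \<or> D \<inter> {{a, b}, {b, c}, {c, a}} = {{a, b}, {c, a}}"
      using that D disj by auto
    then show ?thesis using abc(1) by (auto simp: doubleton_eq_iff card_insert_if)
  qed
  have tri: "even (card (D \<inter> {{a, b}, {b, c}, {c, a}}))"
    if abc: "distinct [a, b, c]" "{{a, b}, {b, c}, {c, a}} \<subseteq> E" for a b c
  proof (cases "D \<inter> {{a, b}, {b, c}, {c, a}} = {}")
    case False
    then consider "{a, b} \<in> D" | "{b, c} \<in> D" | "{c, a} \<in> D" by auto
    then have "card (D \<inter> {{a, b}, {b, c}, {c, a}}) = 2"
    proof cases
      case 1
      then show ?thesis using D[of a b] two[of a b c] two[of b a c] abc by (auto simp: insert_commute)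
    next
      case 2
      then show ?thesis using D[of b c] two[of b c a] two[of c b a] abc by (auto simp: insert_commute)
    next
      case 3
      then show ?thesis using D[of c a] two[of c a b] two[of a c b] abc by (auto simp: insert_commute)
    qed
    then show ?thesis by simp
  qed simp
  define Lo where "Lo = {u \<in> V. lev u \<le> n - 1}"
  have x': "{parent x, x} \<in> E" "lev (parent x) = n - 1" "parent x \<in> V"
    and y': "{parent y, y} \<in> E" "lev (parent y) = n - 1" "parent y \<in> V"
    using parent[of x] parent[of y] xy pos ly n edge_in by (auto simp: n_def)
  have "(parent y, root) \<in> linked E Lo" "(parent x, root) \<in> linked E Lo"
    using linked_root[OF x'(3)] linked_root[OF y'(3)] x'(2) y'(2) by (simp_all add: Lo_def)
  then have "(parent y, parent x) \<in> linked E Lo"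
    using linked_commute rtrancl_trans by metis
  then obtain q where q: "path_between Lo E (parent y) (parent x) q"
    using linked_iff_path_between[of "parent y" Lo] y' by (auto simp: Lo_def)
  obtain p where p: "path_between (above n) E x y p"
    using up linked_iff_path_between[of x "above n"] xy by (auto simp: above_def n_def)
  note pq = p[unfolded path_between_def] q[unfolded path_between_def]
  \<comment> \<open>The two parents may coincide, so \<open>q\<close> can be a single vertex;
    \<open>p\<close> has at least two, which makes three in all.\<close>
  have "x \<noteq> y" using xK yK by auto
  then have "2 \<le> length p" using pq(1) by (cases p; cases "tl p"; auto)
  moreover have "1 \<le> length q" using pq(2) by (cases q) auto
  ultimately have len: "3 \<le> length (p @ q)" by simp
  have sep: "above n \<inter> Lo = {}" using n by (auto simp: above_def Lo_def)
  have edges: "cycle_edges (p @ q) = insert {parent x, x} (path_edges p \<union> {{y, parent y}} \<union> path_edges q)"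
    using cycle_edges_conv_path_edges[of "p @ q"] len pq path_edges_append[of p q] by auto
  have pE: "path_edges p \<subseteq> E" "path_edges q \<subseteq> E"
    using pq by (simp_all add: path_edges_subset_iff_successively)
  have "is_cycle V E (p @ q)"
    unfolding is_cycle_def edges
    using pq len pE x' y' sep by (auto simp: insert_commute above_def Lo_def)
  then have "even (card (D \<inter> cycle_edges (p @ q)))"
    using cocycle[of D] \<open>finite D\<close> tri by (auto simp: D_def)
  \<comment> \<open>All other edges miss the cut: \<open>y\<close> is outside \<open>K\<close>,
    \<open>p\<close> never descends to level \<open>n - 1\<close>, and \<open>q\<close> never rises
    to level \<open>n\<close>.\<close>
  moreover have "D \<inter> cycle_edges (p @ q) = {{parent x, x}}"
  proof -
    have "{parent x, x} \<in> D" using x' xK by (auto simp: D M_def level_def)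
    moreover have "{y, parent y} \<notin> D" using yK Kn y' n by (auto simp: D level_def)
    moreover have "e \<notin> D" if "e \<in> path_edges p" for e
      using path_edges_subset_set[OF that] pq(1) n by (auto simp: D_def M_def level_def above_def)
    moreover have "e \<notin> D" if "e \<in> path_edges q" for e
    proof
      assume "e \<in> D"
      then obtain a where "a \<in> K" "a \<in> e" by (auto simp: D_def)
      then have "a \<in> level n" "a \<in> Lo" using path_edges_subset_set[OF that] pq(2) Kn by blast+
      then show False using n by (simp add: level_def Lo_def)
    qed
    ultimately show ?thesis unfolding edges by blast
  qed
  ultimately show False by simp
qed

text \<open>A pair \<open>(a, b)\<close> stands for a vertex at distance \<open>min a b\<close> from
  the ancestor of \<open>x\<close> that is \<open>a + r - b\<close> levels below it. This ancestor
  is at most \<open>max a b - min a b\<close> from \<open>X r\<close>, so the vertex is within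
  \<open>max a b\<close>, hence within \<open>r\<close>, of \<open>X r\<close>. There are
  \<open>(r + 1) ^ 2\<close> such pairs.\<close>

lemma large_ball:
  assumes level_linked: "\<And>x y. \<lbrakk>x \<in> V; y \<in> V; sim x y; 0 < lev x\<rbrakk> \<Longrightarrow> (x, y) \<in> linked E (level (lev x))"
    and xy: "x \<in> V" "y \<in> V" "sim x y" and far: "6 * r < d x y"
  shows "\<exists>v\<in>V. r ^ 2 < card (graph_ball V E v r)"
proof -
  define n where "n = lev x"
  have ly: "lev y = n" using xy by (simp add: sim_def n_def)
  \<comment> \<open>The route through the root shows that \<open>n\<close> exceeds
    \<open>3 * r\<close>, so every level used, down to \<open>n - 2 * r\<close>, is
    positive.\<close>
  have "d x y \<le> n + n"
    using dist_triangle[of x root y] dist_commute[of x root] xy root_in ly by (simp add: n_def)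
  then have n: "3 * r < n" using far by simp
  define X where "X i = anc i x" for i
  have X: "X i \<in> V" "lev (X i) = n - i" if "i \<le> n" for i
    using anc[of x i] xy that by (auto simp: X_def n_def)
  have dX: "d (X i) (X j) \<le> k" if "i \<le> n" "j \<le> n" "i \<le> j + k" "j \<le> i + k" for i j k
  proof (cases "i \<le> j")
    case True
    then show ?thesis using dist_anc[of x i "j - i"] xy that by (auto simp: X_def n_def)
  next
    case False
    then show ?thesis
      using dist_anc[of x j "i - j"] dist_commute[OF X(1) X(1), of i j] xy that by (auto simp: X_def n_def)
  qed
  \<comment> \<open>At most \<open>2 * r\<close> is lost at either end, so the ancestors are more
    than \<open>2 * r\<close> apart, and a walk inside their level attains the distance
    \<open>k\<close>.\<close>
  have reach: "\<exists>z. z \<in> V \<and> lev z = n - i \<and> d (X i) z = k" if "i \<le> 2 * r" "k \<le> 2 * r" for i k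
  proof -
    have i: "i < n" using that n by simp
    have Y: "anc i y \<in> V" "lev (anc i y) = n - i" using anc[of y i] xy ly i by auto
    have "(X i, y) \<in> linked E (above (n - i))"
    proof -
      have "(X i, x) \<in> linked E (above (n - i))" using linked_anc[of x i] xy i by (simp add: X_def n_def)
      moreover have "(x, y) \<in> linked E (above (n - i))"
        by (rule linked_mono[of _ _ E "above n"]) (use xy in \<open>auto simp: sim_def n_def above_def\<close>)
      ultimately show ?thesis by (meson rtrancl_trans)
    qed
    moreover have "(y, anc i y) \<in> linked E (above (n - i))"
      using linked_anc[of y i] xy i ly by (auto intro: linked_commute)
    ultimately have "(X i, anc i y) \<in> linked E (above (n - i))" by (meson rtrancl_trans)
    then have "sim (X i) (anc i y)" using X[of i] Y i by (simp add: sim_def)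
    then have *: "(X i, anc i y) \<in> linked E (level (n - i))"
      using level_linked[of "X i" "anc i y"] X[of i] Y i by simp
    have "d x y \<le> d x (X i) + d (X i) (anc i y) + d (anc i y) y"
      using dist_triangle[of x "X i" y] dist_triangle[of "X i" "anc i y" y] X[of i] Y i xy by simp
    moreover have "d x (X i) \<le> i" using dX[of 0 i i] i by (simp add: X_def anc_0)
    moreover have "d (anc i y) y \<le> i"
      using dist_anc[of y 0 i] dist_commute[of y "anc i y"] xy Y ly i by (simp add: anc_0)
    ultimately have "k \<le> d (X i) (anc i y)" using far that by linarith
    then obtain z where "z \<in> level (n - i)" "d (X i) z = k"
      using linked_attains_dist[OF *] X[of i] i by (auto simp: level_def)
    then show ?thesis by (auto simp: level_def)
  qed
  \<comment> \<open>Level and distance of \<open>z (a, b)\<close> together determine \<open>a\<close> and \<open>b\<close>.\<close>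
  define z where "z = (\<lambda>(a, b). SOME z. z \<in> V \<and> lev z = n - (a + r - b) \<and> d (X (a + r - b)) z = min a b)"
  have z: "z (a, b) \<in> V" "lev (z (a, b)) = n - (a + r - b)" "d (X (a + r - b)) (z (a, b)) = min a b"
    if "a \<le> r" "b \<le> r" for a b
    using someI_ex[OF reach[of "a + r - b" "min a b"]] that by (auto simp: z_def)
  have "inj_on z ({..r} \<times> {..r})"
  proof (rule inj_onI)
    fix s t assume "s \<in> {..r} \<times> {..r}" "t \<in> {..r} \<times> {..r}" "z s = z t"
    then obtain a b a' b' where st: "s = (a, b)" "t = (a', b')"
      and ab: "a \<le> r" "b \<le> r" "a' \<le> r" "b' \<le> r" and eq: "z (a, b) = z (a', b')"
      by auto
    have "n - (a + r - b) = n - (a' + r - b')" using z(2)[of a b] z(2)[of a' b'] ab eq by simp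
    \<comment> \<open>\<open>a + r - b\<close> is at most \<open>2 * r\<close>, which is below
      \<open>n\<close>, so truncated subtraction loses nothing.\<close>
    then have i: "a + r - b = a' + r - b'" using n ab by simp
    then have "min a b = min a' b'" using z(3)[of a b] z(3)[of a' b'] ab eq by simp
    then show "s = t" using i ab st by auto
  qed
  moreover have "z ` ({..r} \<times> {..r}) \<subseteq> graph_ball V E (X r) r"
  proof clarify
    fix a b assume ab: "a \<le> r" "b \<le> r"
    have "d (X r) (X (a + r - b)) \<le> max a b - min a b"
      using ab n by (intro dX) auto
    moreover have "d (X r) (z (a, b)) \<le> d (X r) (X (a + r - b)) + min a b"
      using dist_triangle[of "X r" "X (a + r - b)" "z (a, b)"] X(1)[of r] X(1)[of "a + r - b"] z[of a b] ab n by simp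
    moreover have "max a b - min a b + min a b \<le> r" using ab by auto
    ultimately have "d (X r) (z (a, b)) \<le> r" by linarith
    then show "z (a, b) \<in> graph_ball V E (X r) r" using z ab by (simp add: graph_ball_def)
  qed
  \<comment> \<open>Comparing cardinalities needs a finite ball; here local finiteness
    enters.\<close>
  ultimately have "card ({..r} \<times> {..r}) \<le> card (graph_ball V E (X r) r)"
    using finite_ball[OF locally_finite] X[of r] n by (intro card_inj_on_le) auto
  then have "Suc r * Suc r \<le> card (graph_ball V E (X r) r)" by (simp add: card_cartesian_product)
  then have "r ^ 2 < card (graph_ball V E (X r) r)" by (simp add: power2_eq_square)
  then show ?thesis using X[of r] n by auto
qed

end

section \<open>The tree of classes\<close>

text \<open>Edges inside a fibre of \<open>f\<close> collapse and all others survive, so the image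
  of a walk is not longer.\<close>

lemma relpow_adj_contract:
  assumes "\<And>u v. {u, v} \<in> E \<Longrightarrow> f u = f v \<or> {f u, f v} \<in> E'" "(x, y) \<in> adj E ^^ n"
  shows "\<exists>m\<le>n. (f x, f y) \<in> adj E' ^^ m"
  using assms(2)
proof (induction n arbitrary: y)
  case (Suc n)
  then obtain z where z: "(x, z) \<in> adj E ^^ n" "{z, y} \<in> E" by (auto simp: adj_iff)
  then obtain m where m: "m \<le> n" "(f x, f z) \<in> adj E' ^^ m" using Suc.IH by blast
  show ?case
  proof (cases "f z = f y")
    case True
    then show ?thesis using m by (intro exI[of _ m]) simp
  next
    case False
    then have "(f z, f y) \<in> adj E'" using assms(1)[OF z(2)] by (simp add: adj_iff)
    then show ?thesis using m by (intro exI[of _ "Suc m"]) auto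
  qed
qed simp

context rooted_graph
begin

text \<open>Stepping up to \<open>x\<close>, following the link to \<open>x'\<close> and stepping
  down again never leaves the levels from \<open>lev u\<close> on. So a class has only one class
  below it.\<close>

lemma sim_parents:
  assumes "sim x x'" "{u, x} \<in> E" "{u', x'} \<in> E" "lev x = Suc (lev u)" "lev x' = Suc (lev u')"
  shows "sim u u'"
proof -
  have eq: "lev u = lev u'" using assms by (simp add: sim_def)
  have "(u, x) \<in> linked E (above (lev u))" "(x', u') \<in> linked E (above (lev u))"
    using assms edge_in eq by (auto intro!: linked_edge simp: above_def insert_commute)
  moreover have "(x, x') \<in> linked E (above (lev u))"
    by (rule linked_mono[of _ _ E "above (lev x)"]) (use assms in \<open>auto simp: sim_def above_def\<close>)
  ultimately have "(u, u') \<in> linked E (above (lev u))" by (meson rtrancl_trans)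
  then show ?thesis using eq by (simp add: sim_def)
qed

lemma sim_edge: "{u, v} \<in> E \<Longrightarrow> lev u = lev v \<Longrightarrow> sim u v"
  using edge_in by (auto simp: sim_def above_def intro!: linked_edge)

text \<open>Edges between classes join consecutive levels and each class has at most one lower
  neighbour; a highest class on a cycle would have two. Bounded classes allow walks in the quotient
  to be lifted at bounded cost.\<close>

lemma quasi_isometric_tree:
  assumes bounded: "\<And>x y. \<lbrakk>x \<in> V; y \<in> V; sim x y\<rbrakk> \<Longrightarrow> d x y \<le> D"
  shows "\<exists>(V' :: nat set) E'. tree V' E' \<and> quasi_isometric V E V' E'"
proof -
  \<comment> \<open>A class is named by the least code of its members, which places the tree on the
    natural numbers.\<close>
  define f where "f x = (LEAST k. \<exists>y\<in>V. sim x y \<and> to_nat_on V y = k)" for x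
  have f_sim: "f x = f y \<longleftrightarrow> sim x y" if xy: "x \<in> V" "y \<in> V" for x y
  proof
    assume eq: "f x = f y"
    have "\<exists>x'\<in>V. sim z x' \<and> to_nat_on V x' = f z" if "z \<in> V" for z
      unfolding f_def by (rule LeastI_ex) (use that sim_refl in blast)
    then obtain x' y' where "x' \<in> V" "y' \<in> V" "sim x x'" "sim y y'" "to_nat_on V x' = f x" "to_nat_on V y' = f y"
      using xy by metis
    moreover from this have "x' = y'"
      using eq countable_vertices by (metis from_nat_into_to_nat_on)
    ultimately show "sim x y" using sim_sym sim_trans by metis
  next
    assume "sim x y"
    then have "sim x z \<longleftrightarrow> sim y z" for z using sim_sym sim_trans by metis
    then show "f x = f y" by (simp add: f_def)
  qed
  define V' where "V' = f ` V"
  define E' where "E' = {{f u, f v} | u v. {u, v} \<in> E \<and> f u \<noteq> f v}"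
  have contract: "f u = f v \<or> {f u, f v} \<in> E'" if "{u, v} \<in> E" for u v
    using that by (auto simp: E'_def)
  have graph': "graph V' E'" using edge_in by (auto simp: graph_def E'_def V'_def)
  have conn: "conn_graph V' E'"
  proof
    have "\<exists>p. path_between V' E' (f x) (f y) p" if xy: "x \<in> V" "y \<in> V" for x y
    proof -
      obtain m where "(f x, f y) \<in> adj E' ^^ m"
        using relpow_adj_contract[of E f E', OF contract dist_relpow[OF xy]] by blast
      moreover have "adj E' \<inter> V' \<times> V' = adj E'"
        using graph' by (fastforce simp: graph_def adj_iff)
      ultimately show ?thesis
        using relpow_adj_imp_path_between[of "f x" "f y" m E' V'] xy by (auto simp: V'_def)
    qed
    then show "connected_graph V' E'"
      unfolding connected_graph_def using graph' root_in by (auto simp: V'_def)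
  qed
  interpret T: conn_graph V' E' by (fact conn)
  define h where "h s = lev (inv_into V f s)" for s
  have h: "h (f x) = lev x" if "x \<in> V" for x
    using that f_sim[of "inv_into V f (f x)" x] by (simp add: h_def sim_def inv_into_into f_inv_into_f)
  have E'E: "\<exists>u v. {u, v} \<in> E \<and> s = f u \<and> t = f v \<and> f u \<noteq> f v" if st: "{s, t} \<in> E'" for s t
  proof -
    obtain u v where "{u, v} \<in> E" "f u \<noteq> f v" "{s, t} = {f u, f v}" using st by (auto simp: E'_def)
    moreover from this have "{v, u} \<in> E" by (simp add: insert_commute)
    ultimately show ?thesis unfolding doubleton_eq_iff by metis
  qed
  have step: "h s = Suc (h t) \<or> h t = Suc (h s)" if st: "{s, t} \<in> E'" for s t
  proof -
    obtain u v where uv: "{u, v} \<in> E" "s = f u" "t = f v" "f u \<noteq> f v" using E'E[OF st] by blast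
    have "u \<in> V" "v \<in> V" using edge_in uv by auto
    then have "lev u \<noteq> lev v" using sim_edge f_sim uv by blast
    moreover have "lev v \<le> Suc (lev u)" "lev u \<le> Suc (lev v)"
      using lev_edge[of u v] lev_edge[of v u] uv by (auto simp: insert_commute)
    ultimately show ?thesis using h \<open>u \<in> V\<close> \<open>v \<in> V\<close> uv by auto
  qed
  have lower: "t = t'" if st: "{t, s} \<in> E'" "{t', s} \<in> E'" "h s = Suc (h t)" "h s = Suc (h t')" for s t t'
  proof -
    obtain u x where ux: "{u, x} \<in> E" "t = f u" "s = f x" using E'E[OF st(1)] by blast
    obtain u' x' where ux': "{u', x'} \<in> E" "t' = f u'" "s = f x'" using E'E[OF st(2)] by blast
    have V: "u \<in> V" "x \<in> V" "u' \<in> V" "x' \<in> V" using ux ux' edge_in by auto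
    have "sim x x'" using ux(3) ux'(3) f_sim[OF V(2,4)] by simp
    moreover have "lev x = Suc (lev u)" "lev x' = Suc (lev u')"
      using st(3,4) h[OF V(1)] h[OF V(2)] h[OF V(3)] h[OF V(4)] ux(2,3) ux'(2,3) by simp_all
    ultimately have "sim u u'" using sim_parents ux ux' by blast
    then show ?thesis using f_sim[OF V(1,3)] ux(2) ux'(2) by simp
  qed
  have "\<nexists>p. is_cycle V' E' p"
  proof
    assume "\<exists>p. is_cycle V' E' p"
    then obtain p where p: "is_cycle V' E' p" by blast
    then have "h ` set p \<noteq> {}" by (auto simp: is_cycle_def)
    then have "Max (h ` set p) \<in> h ` set p" by (intro Max_in) auto
    then obtain s where s: "s \<in> set p" "h s = Max (h ` set p)" by (metis imageE)
    obtain t t' where t: "t \<noteq> t'" "t \<in> set p" "t' \<in> set p" "{t, s} \<in> E'" "{s, t'} \<in> E'"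
      using cycle_neighbours[OF p s(1)] .
    \<comment> \<open>At a highest class both neighbours are one level lower, since adjacent classes
      are never on the same level.\<close>
    have "h t \<le> h s" "h t' \<le> h s" using s t by auto
    then have "h s = Suc (h t)" "h s = Suc (h t')" using step[OF t(4)] step[OF t(5)] by auto
    then show False using lower[of t s t'] t by (simp add: insert_commute)
  qed
  then have "tree V' E'" using T.connected by (simp add: tree_def)
  moreover have "quasi_isometry V E V' E' f"
  proof -
    have upper: "T.d (f x) (f y) \<le> d x y" if xy: "x \<in> V" "y \<in> V" for x y
    proof -
      obtain m where "m \<le> d x y" "(f x, f y) \<in> adj E' ^^ m"
        using relpow_adj_contract[of E f E', OF contract dist_relpow[OF xy]] by blast
      then show ?thesis using T.dist_le_relpow[of "f x" "f y" m] xy by (auto simp: V'_def)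
    qed
    \<comment> \<open>A quotient edge lifts to an edge of \<open>E\<close>, and moving within a
      class costs at most \<open>D\<close>. So each step costs at most \<open>D + 1\<close>, with
      one further \<open>D\<close> for the class of \<open>x\<close>.\<close>
    have lower: "d x y \<le> n * Suc D + D" if "(f x, f y) \<in> adj E' ^^ n" "x \<in> V" "y \<in> V" for n x y
      using that
    proof (induction n arbitrary: y)
      case 0
      then show ?case using bounded f_sim by simp
    next
      case (Suc n)
      then obtain s where s: "(f x, s) \<in> adj E' ^^ n" "{s, f y} \<in> E'" by (auto simp: adj_iff)
      obtain u v where uv: "{u, v} \<in> E" "s = f u" "f y = f v" using E'E[OF s(2)] by blast
      have V: "u \<in> V" "v \<in> V" using uv edge_in by auto
      have "d x u \<le> n * Suc D + D" using Suc.IH[of u] s uv V Suc.prems by simp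
      moreover have "d u v \<le> 1" using dist_edge uv by simp
      moreover have "d v y \<le> D" using bounded[of v y] f_sim[of v y] uv(3) V Suc.prems by simp
      ultimately show ?case
        using dist_triangle[of x u y] dist_triangle[of u v y] V Suc.prems by simp
    qed
    have "inverse (real (Suc D)) * real (d x y) - real D \<le> real (T.d (f x) (f y)) \<and>
        real (T.d (f x) (f y)) \<le> real (Suc D) * real (d x y) + real D"
      if xy: "x \<in> V" "y \<in> V" for x y
    proof
      have "d x y \<le> T.d (f x) (f y) * Suc D + D"
        using lower T.dist_relpow xy by (simp add: V'_def)
      then have "real (d x y) \<le> real (T.d (f x) (f y) * Suc D + D)" by (simp only: of_nat_le_iff)
      \<comment> \<open>Enlarging \<open>D\<close> to \<open>D * (D + 1)\<close> gives the lower
        bound with constants \<open>Suc D\<close> and \<open>D\<close>.\<close>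
      also have "\<dots> \<le> (real (T.d (f x) (f y)) + real D) * real (Suc D)" by (simp add: algebra_simps)
      finally have "real (d x y) / real (Suc D) \<le> real (T.d (f x) (f y)) + real D"
        by (subst pos_divide_le_eq) auto
      then show "inverse (real (Suc D)) * real (d x y) - real D \<le> real (T.d (f x) (f y))"
        by (simp add: field_simps)
      have "real (T.d (f x) (f y)) \<le> real (d x y)" using upper xy by simp
      also have "\<dots> \<le> real (Suc D) * real (d x y) + real D" by (simp add: algebra_simps)
      finally show "real (T.d (f x) (f y)) \<le> real (Suc D) * real (d x y) + real D" .
    qed
    moreover have "\<exists>x\<in>V. real (T.d z (f x)) \<le> real D" if z: "z \<in> V'" for z
    proof -
      obtain x where x: "x \<in> V" "z = f x" using z by (auto simp: V'_def)
      then have "T.d z (f x) = 0" using T.dist_self z by simp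
      then show ?thesis using x(1) by (intro bexI[of _ x]) simp_all
    qed
    moreover have "f \<in> V \<rightarrow> V'" by (simp add: V'_def)
    moreover have "1 \<le> real (Suc D)" "0 \<le> real D" by simp_all
    ultimately show ?thesis unfolding quasi_isometry_def by blast
  qed
  ultimately show ?thesis unfolding quasi_isometric_def by blast
qed

end

section \<open>From the 1-complex to arcs in the complex plane\<close>

text \<open>The plane graph lives in \<open>real ^ 2\<close> and the Jordan curve arguments in
  \<open>complex\<close>; faces are carried over by a linear isomorphism.\<close>

lemma components_linear_bij:
  fixes h :: "'a::euclidean_space \<Rightarrow> 'b::euclidean_space"
  assumes h: "linear h" "linear g" "\<And>x. g (h x) = x" "\<And>y. h (g y) = y"
    and C: "C \<in> components S"
  shows "h ` C \<in> components (h ` S)"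
proof -
  have C': "C \<noteq> {}" "C \<subseteq> S" "connected C" "\<And>D. D \<noteq> {} \<Longrightarrow> C \<subseteq> D \<Longrightarrow> D \<subseteq> S \<Longrightarrow> connected D \<Longrightarrow> D = C"
    using C unfolding in_components_maximal by metis+
  have "D = h ` C" if "D \<noteq> {}" "h ` C \<subseteq> D" "D \<subseteq> h ` S" "connected D" for D
  proof -
    have conn: "connected (g ` D)" using connected_linear_image h(2) that(4) by blast
    have "g ` h ` T = T" for T using h(3) by (simp add: image_image)
    then have "C \<subseteq> g ` D" "g ` D \<subseteq> S" "g ` D \<noteq> {}"
      using that(1) image_mono[OF that(2), of g] image_mono[OF that(3), of g] by auto
    then have "g ` D = C" using C'(4)[of "g ` D"] conn by simp
    moreover have "h ` g ` D = D" using h(4) by (simp add: image_image)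
    ultimately show ?thesis by simp
  qed
  moreover have "connected (h ` C)" using connected_linear_image h(1) C'(3) by blast
  ultimately show ?thesis using C'(1,2) unfolding in_components_maximal by blast
qed

lemma frontier_linear_bij:
  fixes h :: "'a::euclidean_space \<Rightarrow> 'b::euclidean_space"
  assumes "linear h" "bij h"
  shows "frontier (h ` S) = h ` frontier S"
  using assms closure_injective_linear_image[of h] bij_image_Compl_eq[of h]
  by (simp add: frontier_closures bij_is_inj image_Int)

section \<open>Cells in barycentric coordinates\<close>

definition vertex_point :: "'v \<Rightarrow> 'v \<Rightarrow> real" where
  "vertex_point v = (\<lambda>w. if w = v then 1 else 0)"

definition edge_point :: "'v \<Rightarrow> 'v \<Rightarrow> real \<Rightarrow> 'v \<Rightarrow> real" where
  "edge_point u v t = (\<lambda>w. if w = u then 1 - t else if w = v then t else 0)"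

lemma cell_singleton: "cell {v} = {vertex_point v}"
  by (auto simp: cell_def vertex_point_def)

lemma cell_Int:
  assumes "finite s" "finite t"
  shows "cell s \<inter> cell t = cell (s \<inter> t)"
proof -
  have "x \<in> cell s \<and> x \<in> cell t \<longleftrightarrow> x \<in> cell (s \<inter> t)" for x :: "'a \<Rightarrow> real"
  proof (cases "\<forall>w. w \<notin> s \<inter> t \<longrightarrow> x w = 0")
    case True
    then have "sum x (s \<inter> t) = sum x s" "sum x (s \<inter> t) = sum x t"
      using assms by (auto intro!: sum.mono_neutral_left)
    then show ?thesis using True by (auto simp: cell_def)
  next
    case False
    then show ?thesis by (auto simp: cell_def)
  qed
  then show ?thesis by blast
qed

lemma cell_doubleton:
  assumes "u \<noteq> v"
  shows "cell {u, v} = edge_point u v ` {0..1}"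
proof
  show "edge_point u v ` {0..1} \<subseteq> cell {u, v}"
    using assms by (auto simp: cell_def edge_point_def)
  show "cell {u, v} \<subseteq> edge_point u v ` {0..1}"
  proof
    fix x assume x: "x \<in> cell {u, v}"
    then have "0 \<le> x u" "0 \<le> x v" "x u + x v = 1" "\<And>w. w \<noteq> u \<Longrightarrow> w \<noteq> v \<Longrightarrow> x w = 0"
      using assms by (auto simp: cell_def)
    then have "x = edge_point u v (x v)" "x v \<in> {0..1}" by (auto simp: edge_point_def)
    then show "x \<in> edge_point u v ` {0..1}" by blast
  qed
qed

lemma continuous_on_edge_point: "continuous_on S (edge_point u v)"
proof (rule continuous_on_coordinatewise_then_product)
  show "continuous_on S (\<lambda>t. edge_point u v t w)" for w
    unfolding edge_point_def by (cases "w = u"; cases "w = v") (auto intro: continuous_intros)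
qed

lemma edge_point_0: "edge_point u v 0 = vertex_point u"
  by (auto simp: edge_point_def vertex_point_def)

lemma edge_point_1: "u \<noteq> v \<Longrightarrow> edge_point u v 1 = vertex_point v"
  by (auto simp: edge_point_def vertex_point_def)

lemma inj_on_edge_point: "u \<noteq> v \<Longrightarrow> inj_on (edge_point u v) S"
  by (rule inj_onI) (metis edge_point_def)

lemma inj_vertex_point: "inj vertex_point"
  by (rule injI) (metis vertex_point_def zero_neq_one)

lemma edges_cell_Int:
  assumes "graph V E" "e \<in> E" "e' \<in> E" "e \<noteq> e'"
  shows "cell e \<inter> cell e' = vertex_point ` (e \<inter> e')"
proof -
  have fin: "finite e" "finite e'" "card e = 2" "card e' = 2"
    using assms by (auto simp: graph_def intro: card_ge_0_finite)
  have "\<not> e \<subseteq> e'" using fin assms(4) card_subset_eq by metis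
  then have "e \<inter> e' \<subset> e" by blast
  then have "card (e \<inter> e') < 2" using fin psubset_card_mono by metis
  then have "card (e \<inter> e') = 0 \<or> card (e \<inter> e') = 1" by linarith
  then consider "e \<inter> e' = {}" | v where "e \<inter> e' = {v}" using fin by (auto simp: card_1_singleton_iff)
  then show ?thesis
  proof cases
    case 1
    then show ?thesis unfolding cell_Int[OF fin(1,2)] by (simp add: cell_def)
  next
    case 2
    then show ?thesis unfolding cell_Int[OF fin(1,2)] by (simp add: cell_singleton)
  qed
qed

text \<open>Distinct edges share only vertices, and a parameter strictly between 0 and 1 does not
  give a vertex.\<close>

lemma edge_point_in_cell:
  assumes "graph V E" "{u, v} \<in> E" "u \<noteq> v" "e \<in> E" "0 < t" "t < 1" "edge_point u v t \<in> cell e"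
  shows "e = {u, v}"
proof (rule ccontr)
  assume "e \<noteq> {u, v}"
  moreover have "edge_point u v t \<in> cell {u, v}" using assms cell_doubleton by fastforce
  ultimately obtain w where "edge_point u v t = vertex_point w"
    using edges_cell_Int[OF assms(1,4,2)] assms(7) by blast
  then have "edge_point u v t v = vertex_point w v" by simp
  then show False using assms(3,5,6) by (simp add: edge_point_def vertex_point_def split: if_splits)
qed

section \<open>Local finiteness and the edges as arcs\<close>

locale plane =
  fixes V :: "'v set" and E :: "'v set set" and \<phi> :: "('v \<Rightarrow> real) \<Rightarrow> real ^ 2"
  assumes plane_graph: "plane_graph V E \<phi>"
begin

lemma graph: "graph V E"
  using plane_graph by (simp add: plane_graph_def)

lemma homeomorphic: "homeomorphic_map (one_complex V E) (top_of_set (\<phi> ` complex_points V E)) \<phi>"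
  using plane_graph by (simp add: plane_graph_def embedding_map_def topspace_one_complex)

lemma inj: "inj_on \<phi> (complex_points V E)"
  using homeomorphic_imp_injective_map[OF homeomorphic] by (simp add: topspace_one_complex)

lemma vertex_in: "v \<in> V \<Longrightarrow> vertex_point v \<in> complex_points V E"
  by (auto simp: complex_points_def cell_singleton)

lemma cell_in: "e \<in> E \<Longrightarrow> cell e \<subseteq> complex_points V E"
  by (auto simp: complex_points_def)

lemma continuous_on_cell:
  assumes "e \<in> E"
  shows "continuous_on (cell e) \<phi>"
  unfolding continuous_openin_preimage_eq
proof (intro allI impI)
  fix B :: "(real ^ 2) set" assume B: "open B"
  have "continuous_map (one_complex V E) euclidean \<phi>"
    using homeomorphic_imp_continuous_map[OF homeomorphic] by (simp add: continuous_map_in_subtopology)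
  then have "openin (one_complex V E) (complex_points V E \<inter> \<phi> -` B)"
    using B by (simp add: continuous_map_openin_preimage_eq topspace_one_complex)
  then have "openin (top_of_set (cell e)) (complex_points V E \<inter> \<phi> -` B \<inter> cell e)"
    using assms by (simp add: openin_one_complex)
  moreover have "complex_points V E \<inter> \<phi> -` B \<inter> cell e = cell e \<inter> \<phi> -` B"
    using cell_in[OF assms] by blast
  ultimately show "openin (top_of_set (cell e)) (cell e \<inter> \<phi> -` B)" by simp
qed

lemma edge_in: "{u, v} \<in> E \<Longrightarrow> u \<in> V \<and> v \<in> V \<and> u \<noteq> v"
  using graph by (fastforce simp: graph_def)

text \<open>At a vertex of infinite degree the weak topology is not first countable.\<close>

lemma finite_neighbours:
  assumes u: "u \<in> V"
  shows "finite {v. {u, v} \<in> E}"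
proof (rule ccontr)
  assume "infinite {v. {u, v} \<in> E}"
  then obtain f :: "nat \<Rightarrow> 'v" where f: "inj f" "range f \<subseteq> {v. {u, v} \<in> E}"
    using infinite_countable_subset by blast
  then have fE: "{u, f n} \<in> E" for n by blast
  then have uf: "u \<noteq> f n" for n using edge_in by blast
  \<comment> \<open>On each of infinitely many edges at \<open>u\<close> an interior point is chosen
    so that the images converge to that of \<open>u\<close> in the plane.\<close>
  have "\<exists>t. 0 < t \<and> t < 1 \<and> dist (\<phi> (edge_point u (f n) t)) (\<phi> (vertex_point u)) < inverse (real (Suc n))" for n
  proof -
    have "continuous_on {0..1} (\<lambda>t. \<phi> (edge_point u (f n) t))"
      by (rule continuous_on_compose2[OF continuous_on_cell[OF fE[of n]] continuous_on_edge_point])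
        (simp add: cell_doubleton[OF uf])
    then obtain \<delta> where \<delta>: "0 < \<delta>" "\<And>t. t \<in> {0..1} \<Longrightarrow> dist t 0 < \<delta> \<Longrightarrow>
        dist (\<phi> (edge_point u (f n) t)) (\<phi> (edge_point u (f n) 0)) < inverse (real (Suc n))"
      unfolding continuous_on_iff
      by (metis atLeastAtMost_iff inverse_positive_iff_positive of_nat_0_less_iff order_refl zero_less_Suc zero_le_one)
    show ?thesis
      using \<delta>(1) \<delta>(2)[of "min (\<delta> / 2) (1 / 2)"]
      by (intro exI[of _ "min (\<delta> / 2) (1 / 2)"]) (auto simp: edge_point_0)
  qed
  then obtain t where t: "\<And>n. 0 < t n" "\<And>n. t n < 1"
    "\<And>n. dist (\<phi> (edge_point u (f n) (t n))) (\<phi> (vertex_point u)) < inverse (real (Suc n))"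
    by metis
  define x where "x n = edge_point u (f n) (t n)" for n
  have x_cell: "x n \<in> cell {u, f n}" for n
    unfolding x_def cell_doubleton[OF uf] using t(1,2)[of n] by (intro imageI) (auto intro: less_imp_le)
  have x_in: "x n \<in> complex_points V E" for n using cell_in[OF fE] x_cell by blast
  \<comment> \<open>Every closed edge contains at most one of the chosen points, so removing them
    all leaves a set that is open in the weak topology.\<close>
  define U where "U = complex_points V E - range x"
  have "openin (one_complex V E) U"
    unfolding openin_one_complex
  proof (intro conjI ballI)
    fix e assume e: "e \<in> E"
    show "openin (top_of_set (cell e)) (U \<inter> cell e)"
    proof (cases "\<exists>n. e = {u, f n}")
      case True
      then obtain n where n: "e = {u, f n}" by blast
      have "y \<in> range x \<longleftrightarrow> y (f n) = t n" if y: "y \<in> cell e" for y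
      proof
        assume "y \<in> range x"
        then obtain m where m: "y = x m" by blast
        then have "e = {u, f m}"
          using edge_point_in_cell[OF graph fE uf e t(1,2), of m] y by (simp add: x_def)
        then have "m = n" using n f(1) uf by (auto simp: doubleton_eq_iff inj_eq)
        then show "y (f n) = t n" using m uf[of n] by (simp add: x_def edge_point_def)
      next
        assume yn: "y (f n) = t n"
        obtain s where "y = edge_point u (f n) s" using y cell_doubleton[OF uf] n by blast
        moreover from this have "s = t n" using yn uf[of n] by (simp add: edge_point_def)
        ultimately show "y \<in> range x" by (simp add: x_def)
      qed
      then have "U \<inter> cell e = cell e \<inter> (\<lambda>y. y (f n)) -` (- {t n})"
        using cell_in[OF e] by (auto simp: U_def)
      moreover have "continuous_on (cell e) (\<lambda>y. y (f n))"
        by (rule continuous_on_subset[OF continuous_on_product_coordinates]) simp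
      moreover have "open (- {t n})" by (intro open_Compl) simp
      ultimately show ?thesis by (metis continuous_openin_preimage_eq)
    next
      case False
      then have "range x \<inter> cell e = {}"
        using edge_point_in_cell[OF graph fE uf e t(1,2)] by (auto simp: x_def)
      then have "U \<inter> cell e = cell e" using cell_in[OF e] by (auto simp: U_def)
      then show ?thesis by simp
    qed
  qed (auto simp: U_def)
  \<comment> \<open>The image of \<open>U\<close> must contain all image points near
    \<open>\<phi> (vertex_point u)\<close>, among them some \<open>\<phi> (x n)\<close>; by
    injectivity \<open>x n\<close> would lie in \<open>U\<close>.\<close>
  then have "openin (top_of_set (\<phi> ` complex_points V E)) (\<phi> ` U)"
    using homeomorphic_imp_open_map[OF homeomorphic] by (simp add: open_map_def)
  then obtain B where B: "open B" "\<phi> ` U = \<phi> ` complex_points V E \<inter> B"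
    by (auto simp: openin_open)
  have "vertex_point u \<noteq> x n" for n
  proof
    assume "vertex_point u = x n"
    then have "vertex_point u u = x n u" by simp
    then show False using t(1)[of n] by (simp add: vertex_point_def x_def edge_point_def)
  qed
  then have "\<phi> (vertex_point u) \<in> \<phi> ` U" using vertex_in[OF u] by (auto simp: U_def)
  then obtain \<epsilon> where \<epsilon>: "0 < \<epsilon>" "ball (\<phi> (vertex_point u)) \<epsilon> \<subseteq> B"
    using B open_contains_ball by blast
  obtain n where "inverse (real (Suc n)) < \<epsilon>" using reals_Archimedean[OF \<epsilon>(1)] by blast
  then have "\<phi> (x n) \<in> B" using \<epsilon>(2) t(3)[of n] by (auto simp: x_def dist_commute)
  then have "\<phi> (x n) \<in> \<phi> ` U" using B(2) x_in by blast
  then have "x n \<in> U" using inj x_in by (auto simp: U_def inj_on_def)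
  then show False by (simp add: U_def)
qed

lemma arc_graph_image:
  assumes h: "linear h" "inj h"
  shows "arc_graph V E (\<lambda>v. h (\<phi> (vertex_point v))) (\<lambda>e. (h :: real ^ 2 \<Rightarrow> complex) ` \<phi> ` cell e)"
proof
  show "graph V E" by (fact graph)
  show "inj_on (\<lambda>v. h (\<phi> (vertex_point v))) V"
  proof (rule inj_onI)
    fix v w assume "v \<in> V" "w \<in> V" "h (\<phi> (vertex_point v)) = h (\<phi> (vertex_point w))"
    then have "vertex_point v = vertex_point w"
      using h(2) inj_onD[OF inj _ vertex_in vertex_in, of v w] by (simp add: inj_eq)
    then show "v = w" by (rule injD[OF inj_vertex_point])
  qed
next
  have cont: "continuous_on UNIV h"
    using h(1) linear_continuous_on linear_conv_bounded_linear by blast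
  fix u v assume uv: "{u, v} \<in> E"
  then have "u \<noteq> v" using edge_in by blast
  note c = cell_doubleton[OF this]
  have "continuous_on {0..1} (\<lambda>t. \<phi> (edge_point u v t))"
    by (rule continuous_on_compose2[OF continuous_on_cell[OF uv] continuous_on_edge_point]) (simp add: c)
  then have "path (\<lambda>t. h (\<phi> (edge_point u v t)))"
    unfolding path_def by (rule continuous_on_compose2[OF cont]) simp
  moreover have "inj_on (\<lambda>t. h (\<phi> (edge_point u v t))) {0..1}"
  proof (rule inj_onI)
    fix s t :: real assume st: "s \<in> {0..1}" "t \<in> {0..1}" "h (\<phi> (edge_point u v s)) = h (\<phi> (edge_point u v t))"
    then have "\<phi> (edge_point u v s) = \<phi> (edge_point u v t)" using h(2) by (simp add: inj_eq)
    moreover have "edge_point u v s \<in> complex_points V E" "edge_point u v t \<in> complex_points V E"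
      using st(1,2) c cell_in[OF uv] by auto
    ultimately have "edge_point u v s = edge_point u v t" using inj by (auto simp: inj_on_def)
    then show "s = t" by (rule injD[OF inj_on_edge_point[OF \<open>u \<noteq> v\<close>, of UNIV]])
  qed
  moreover have "path_image (\<lambda>t. h (\<phi> (edge_point u v t))) = h ` \<phi> ` cell {u, v}"
    unfolding path_image_def c by (simp add: image_image)
  ultimately show "\<exists>g. arc g \<and> pathstart g = h (\<phi> (vertex_point u)) \<and> pathfinish g = h (\<phi> (vertex_point v)) \<and>
      path_image g = h ` \<phi> ` cell {u, v}"
    using edge_point_1[OF \<open>u \<noteq> v\<close>]
    by (intro exI[of _ "\<lambda>t. h (\<phi> (edge_point u v t))"])
      (auto simp: arc_def pathstart_def pathfinish_def edge_point_0)
next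
  fix e e' assume e: "e \<in> E" "e' \<in> E" "e \<noteq> e'"
  have "h ` \<phi> ` cell e \<inter> h ` \<phi> ` cell e' = h ` (\<phi> ` cell e \<inter> \<phi> ` cell e')"
    using h(2) by (simp add: image_Int)
  also have "\<phi> ` cell e \<inter> \<phi> ` cell e' = \<phi> ` (cell e \<inter> cell e')"
    using inj_on_image_Int[OF inj cell_in[OF e(1)] cell_in[OF e(2)]] by simp
  finally show "h ` \<phi> ` cell e \<inter> h ` \<phi> ` cell e' = (\<lambda>v. h (\<phi> (vertex_point v))) ` (e \<inter> e')"
    using edges_cell_Int[OF graph e] by (simp add: image_image)
qed

end

section \<open>Facial triangles as faces of the arc graph\<close>

lemma card_path_edges: "distinct p \<Longrightarrow> card (path_edges p) = length p - 1"
proof (induction p rule: path_edges.induct)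
  case (1 x y zs)
  have "finite (path_edges q)" for q :: "'a list" by (induction q rule: path_edges.induct) auto
  moreover have "{x, y} \<notin> path_edges (y # zs)"
    using path_edges_subset_set[of "{x, y}" "y # zs"] 1 by auto
  ultimately show ?case using 1 by simp
qed auto

lemma triangle_cycle:
  assumes "is_cycle V E p" "card (cycle_edges p) = 3"
  shows "\<exists>a b c. distinct [a, b, c] \<and> cycle_edges p = {{a, b}, {b, c}, {c, a}}"
proof -
  have p: "3 \<le> length p" "distinct p" using assms by (auto simp: is_cycle_def)
  then have c: "cycle_edges p = insert {last p, hd p} (path_edges p)"
    by (intro cycle_edges_conv_path_edges) simp
  have "finite (path_edges p)" by (induction p rule: path_edges.induct) auto
  then have "card (cycle_edges p) = length p"
    using c closing_edge_notin_path_edges[OF p(2,1)] card_path_edges[OF p(2)] p(1) by simp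
  then have "length p = Suc (Suc (Suc 0))" using assms(2) by simp
  then obtain x y z where "p = [x, y, z]" by (auto simp: length_Suc_conv)
  then have "distinct [x, y, z]" "cycle_edges p = {{x, y}, {y, z}, {z, x}}"
    using c p(2) by auto
  then show ?thesis by blast
qed

lemma (in plane) facial_image:
  assumes T: "facial_triangle V E \<phi> T"
    and h: "linear h" "linear g" "\<And>x. g (h x) = x" "\<And>y. (h :: real ^ 2 \<Rightarrow> complex) (g y) = y"
  shows "\<exists>F. arc_graph.facial V E (\<lambda>v. h (\<phi> (vertex_point v))) (\<lambda>e. h ` \<phi> ` cell e) T F"
proof -
  have bij: "bij h" by (metis bijI' h(3,4))
  interpret A: arc_graph V E "\<lambda>v. h (\<phi> (vertex_point v))" "\<lambda>e. h ` \<phi> ` cell e"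
    using arc_graph_image h(1) bij bij_is_inj by blast
  obtain p where p: "is_cycle V E p" "T = cycle_edges p" "card T = 3"
    using T by (auto simp: facial_triangle_def)
  obtain F where F: "F \<in> components (- (\<phi> ` complex_points V E))" "frontier F = \<phi> ` (\<Union>e\<in>T. cell e)"
    using T by (auto simp: facial_triangle_def faces_def topspace_one_complex)
  have pts: "A.points = h ` \<phi> ` complex_points V E"
    by (auto simp: A.points_def complex_points_def cell_singleton)
  have "h ` F \<in> components (- A.points)"
    using components_linear_bij[OF h F(1)] bij by (simp add: pts bij_image_Compl_eq)
  moreover have "frontier (h ` F) = (\<Union>e\<in>T. h ` \<phi> ` cell e)"
    using frontier_linear_bij[OF h(1) bij] F(2) by (simp add: image_UN)
  ultimately show ?thesis
    using p triangle_cycle[OF p(1)] unfolding A.facial_def by (auto simp: is_cycle_def)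
qed

theorem theorem1p1:
  fixes V :: "'v set" and E :: "'v set set" and \<phi> :: "('v \<Rightarrow> real) \<Rightarrow> real ^ 2"
  assumes "planar_triangulation V E \<phi>"
  shows "(\<exists>(V' :: nat set) E'. tree V' E' \<and> quasi_isometric V E V' E') \<or>
         (\<forall>r :: nat. \<exists>v\<in>V. card (graph_ball V E v r) > r ^ 2)"
proof -
  interpret plane V E \<phi> using assms by unfold_locales (simp add: planar_triangulation_def)
  have conn: "connected_graph V E" using assms by (simp add: planar_triangulation_def)
  then obtain root where "root \<in> V" by (auto simp: connected_graph_def)
  then interpret G: rooted_graph V E root
    by unfold_locales (use conn finite_neighbours in auto)
  obtain h :: "real ^ 2 \<Rightarrow> complex" and g where h: "linear h" "linear g" "\<And>x. g (h x) = x" "\<And>y. h (g y) = y"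
    by (rule isomorphisms_UNIV_UNIV[where 'M = "real ^ 2" and 'N = complex]) auto
  interpret A: arc_graph V E "\<lambda>v. h (\<phi> (vertex_point v))" "\<lambda>e. h ` \<phi> ` cell e"
    using arc_graph_image h(1,3) by (metis injI)
  have tri: "\<exists>S T F F'. S \<noteq> T \<and> A.facial S F \<and> A.facial T F' \<and> e \<in> S \<and> e \<in> T" if "e \<in> E" for e
    using assms that facial_image[OF _ h] unfolding planar_triangulation_def by metis
  \<comment> \<open>A set that is even on all triangles of the graph is even on the facial ones, so
    the planar parity result applies.\<close>
  have cocycle: "even (card (D \<inter> cycle_edges p))"
    if "finite D" "D \<subseteq> E" "is_cycle V E p"
      and even: "\<And>a b c. \<lbrakk>distinct [a, b, c]; {{a, b}, {b, c}, {c, a}} \<subseteq> E\<rbrakk> \<Longrightarrow> even (card (D \<inter> {{a, b}, {b, c}, {c, a}}))"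
    for D p
  proof (rule A.even_cocycle_on_cycle[OF tri])
    fix T F assume "A.facial T F"
    then obtain a b c where "distinct [a, b, c]" "T = {{a, b}, {b, c}, {c, a}}" "T \<subseteq> E"
      unfolding A.facial_def by metis
    then show "even (card (D \<inter> T))" using even[of a b c] by simp
  qed (use that(1-3) in simp_all)
  show ?thesis
  proof (cases "\<exists>D. \<forall>x\<in>V. \<forall>y\<in>V. G.sim x y \<longrightarrow> graph_dist V E x y \<le> D")
    case True
    then show ?thesis using G.quasi_isometric_tree by blast
  next
    case False
    have "\<exists>v\<in>V. r ^ 2 < card (graph_ball V E v r)" for r
    proof -
      \<comment> \<open>Unboundedness of the classes, applied to the bound
        \<open>6 * r\<close>.\<close>
      obtain x y where "x \<in> V" "y \<in> V" "G.sim x y" "6 * r < graph_dist V E x y"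
        using False by (meson not_le)
      then show ?thesis using G.large_ball[OF G.sim_imp_linked_level[OF cocycle]] by blast
    qed
    then show ?thesis by blast
  qed
qed

end
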